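(* Assume that for some $r$ one of the following holds: (i) $r\in(1,2]$ and $\mathbb{E}\xi^r<\infty$; or (ii) $r\in(1,2)$ and, for some $b>0$, $\mathbb{P}\{\xi>t\}\sim b t^{-r}$ as $t\to\infty$. Suppose further that $\mathbb{E}(\eta\wedge t)=O(t^{2-r})$ as $t\to\infty$ with the same $r$. Then, for any positive integer-valued function $j=j(t)$ satisfying $j(t)=o(t^{(r-1)/2})$ as $t\to\infty$, $$V_{j}(t)\sim\frac{t^{j}}{m^{j}\,j!},\qquad t\to\infty,\quad j=j(t),$$ where $m=\mathbb{E}\xi<\infty$.
   Context: Let $(\xi_i,\eta_i)_{i\in\mathbb{N}}$ be independent copies of a random vector $(\xi,\eta)$ whose components are almost surely positive and arbitrarily dependent. Put $S_0:=0$, $S_i:=\xi_1+\cdots+\xi_i$ and $T_i:=S_{i-1}+\eta_i$ for $i\in\mathbb{N}$ (a perturbed random walk). Let $N(t):=\sum_{i\ge1}\mathbf{1}_{\{T_i\le t\}}$ and $V(t):=\mathbb{E}N(t)$ for $t\ge0$, and $V(t):=0$ for $t<0$. Define $V_1:=V$ and, for $j\ge2$ and $t\ge0$, $V_j(t):=\int_{[0,t]}V_{j-1}(t-y)\,dV(y)$ (Lebesgue–Stieltjes integral), i.e. $V_j$ is the $j$-fold Lebesgue–Stieltjes convolution power of $V$. (Equivalently, $V_j(t)$ is the expected number of $j$th generation individuals born in $[0,t]$ in the general branching process started by one ancestor at time $0$ in which each individual independently produces offspring at times, relative to its own birth, distributed as $(T_i)_{i\in\mathbb{N}}$.) Here $x\wedge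 y=\min(x,y)$, and $u(t)\sim v(t)$ means $u(t)/v(t)\to1$ as $t\to\infty$. *)

theory Defs
  imports "HOL-Probability.Probability" "HOL-Library.Landau_Symbols"
begin

text \<open>The sequences \<open>X\<close>, \<open>Y\<close> of summands and perturbations are indexed by
  \<open>i \<ge> 1\<close>; their values at index \<open>0\<close> are never used.\<close>

definition walk :: "(nat \<Rightarrow> 'a \<Rightarrow> real) \<Rightarrow> nat \<Rightarrow> 'a \<Rightarrow> real" where
  "walk X i \<omega> = (\<Sum>k=1..i. X k \<omega>)"

definition perturbed_walk ::
    "(nat \<Rightarrow> 'a \<Rightarrow> real) \<Rightarrow> (nat \<Rightarrow> 'a \<Rightarrow> real) \<Rightarrow> nat \<Rightarrow> 'a \<Rightarrow> real" where
  "perturbed_walk X Y i \<omega> = walk X (i - 1) \<omega> + Y i \<omega>"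

text \<open>The number of indices \<open>i \<ge> 1\<close> with \<open>T i \<le> t\<close>, possibly infinite.\<close>

definition visits ::
    "(nat \<Rightarrow> 'a \<Rightarrow> real) \<Rightarrow> (nat \<Rightarrow> 'a \<Rightarrow> real) \<Rightarrow> real \<Rightarrow> 'a \<Rightarrow> ennreal" where
  "visits X Y t \<omega> = (\<Sum>i. indicator {..t} (perturbed_walk X Y (Suc i) \<omega>))"

text \<open>For i.i.d. almost surely positive summands and almost surely positive
  perturbations the expected number of visits is finite, so \<open>enn2real\<close> loses nothing.\<close>

definition mean_visits ::
    "'a measure \<Rightarrow> (nat \<Rightarrow> 'a \<Rightarrow> real) \<Rightarrow> (nat \<Rightarrow> 'a \<Rightarrow> real) \<Rightarrow> real \<Rightarrow> real" where
  "mean_visits M X Y t = (if t < 0 then 0 else enn2real (\<integral>\<^sup>+\<omega>. visits X Y t \<omega> \<partial>M))"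

text \<open>Lebesgue-Stieltjes convolution powers of a nondecreasing right-continuous
  \<open>F\<close> vanishing on the negative half-line; \<open>interval_measure F\<close> gives \<open>{a<..b}\<close>
  the mass \<open>F b - F a\<close>, hence \<open>{0}\<close> the mass \<open>F 0\<close>. The zeroth power is the
  convolution unit (the distribution function of the point mass at \<open>0\<close>).\<close>

fun stieltjes_conv_power :: "(real \<Rightarrow> real) \<Rightarrow> nat \<Rightarrow> real \<Rightarrow> real" where
  "stieltjes_conv_power F 0 t = indicator {0..} t"
| "stieltjes_conv_power F (Suc 0) t = F t"
| "stieltjes_conv_power F (Suc (Suc n)) t =
     (LINT y:{0..t}|interval_measure F. stieltjes_conv_power F (Suc n) (t - y))"

end

theory Submission
  imports Defs
begin

text \<open>
  The convolution powers of a function within \<open>a / m\<close> of \<open>s \<mapsto> s / m\<close> on \<open>[0, t]\<close> are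
  controlled by shifts. The \<open>j\<close>-fold power of \<open>s \<mapsto> (s - a)\<^sup>+ / m\<close> is
  \<open>((s - j a)\<^sup>+)\<^sup>j / (m\<^sup>j j!)\<close>, and the \<open>j\<close>-fold power of \<open>s \<mapsto> (s + a) / m\<close>, which is that of
  Lebesgue measure with an atom of mass \<open>a / m\<close> at \<open>0\<close>, is at most \<open>(s + j a)\<^sup>j / (m\<^sup>j j!)\<close>.
  Convolution is monotone, so
  \<open>((1 - j a / t)\<^sup>+)\<^sup>j \<le> m\<^sup>j j! V\<^sub>j(t) / t\<^sup>j \<le> (1 + j a / t)\<^sup>j\<close>,
  and both sides tend to \<open>1\<close> once \<open>j\<^sup>2 a / t\<close> tends to \<open>0\<close>
  (\<open>conv_power_asymp_equiv\<close>). With \<open>a\<close> of order \<open>t powr (2 - r)\<close> this is exactly the condition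
  \<open>j = o (t powr ((r - 1) / 2))\<close>. It remains to show
  \<open>m V(s) = s + O (t powr (2 - r))\<close> uniformly in \<open>s \<in> [0, t]\<close>.

  Let \<open>U(t) = \<Sum>\<^sub>i P(S\<^sub>i \<le> t)\<close>. Telescoping \<open>E min (S\<^sub>i, t)\<close> gives
  \<open>m U(t) = t + \<Sum>\<^sub>i E[H (t - S\<^sub>i); S\<^sub>i \<le> t]\<close> with \<open>H(x) = E (\<xi> - x)\<^sup>+\<close>, the last sum being the mean
  overshoot over \<open>t\<close>; and independence of \<open>S\<^sub>i\<close> and \<open>\<eta>\<^sub>i\<^sub>+\<^sub>1\<close> gives
  \<open>U(t) - V(t) = \<Sum>\<^sub>i E[P(\<eta> > t - S\<^sub>i); S\<^sub>i \<le> t]\<close>. Both error terms are renewal sums of a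
  decreasing function \<open>h\<close>, and for these
  \<open>E min (\<xi>, 1) \<cdot> \<Sum>\<^sub>i E[h (t - S\<^sub>i); S\<^sub>i \<le> t] \<le> h(0) + \<integral>\<^sub>0\<^sup>t h\<close> (\<open>renewal_sum_bound\<close>).
  This follows by telescoping \<open>E f (S\<^sub>i)\<close> for a bounded increasing \<open>f\<close> whose increment over one
  step dominates the summand.

  For \<open>h = H\<close> the integral is at most \<open>E (\<xi> min (\<xi>, t)) \<le> t powr (2 - r) E (\<xi> powr r)\<close> under the
  moment condition, while under the tail condition \<open>H(u) = O (u powr (1 - r))\<close>. For
  \<open>h(u) = P(\<eta> > u)\<close> the integral is \<open>E min (\<eta>, t)\<close>, which is \<open>O (t powr (2 - r))\<close> by assumption.
\<close>

section \<open>Convolution powers of an almost linear function\<close>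

text \<open>
  The antiderivative that integrating \<open>(u + c) ^ n * (d - u)\<close> by parts produces. It serves both the
  upper bound (\<open>d = s + a\<close>) and the lower bound (\<open>d = s - a\<close>, with \<open>-c\<close> for \<open>c\<close>).
\<close>

lemma has_derivative_power_by_parts:
  fixes c d m u :: real
  shows "((\<lambda>u. ((u + c) ^ Suc n * (d - u) + (u + c) ^ Suc (Suc n) / Suc (Suc n)) / m)
    has_real_derivative Suc n * (u + c) ^ n * ((d - u) / m)) (at u)"
proof -
  have pow: "((\<lambda>u. (u + c) ^ Suc k) has_real_derivative Suc k * (u + c) ^ k) (at u)" for k
    using DERIV_power[of "\<lambda>u. u + c" 1 u UNIV "Suc k"]
    by (auto intro!: derivative_eq_intros simp del: power_Suc)
  have "((\<lambda>u. ((u + c) ^ Suc n * (d - u) + (u + c) ^ Suc (Suc n) / Suc (Suc n)) / m)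
    has_real_derivative ((Suc n * (u + c) ^ n) * (d - u) + (- 1) * (u + c) ^ Suc n
       + Suc (Suc n) * (u + c) ^ Suc n / Suc (Suc n)) / m) (at u)"
    by (intro DERIV_cdivide DERIV_add DERIV_mult pow) (auto intro!: derivative_eq_intros)
  then show ?thesis
    by (simp del: of_nat_Suc power_Suc)
qed

text \<open>
  Vanishing at \<open>0\<close> itself, and not only to the left of it, excludes an atom at \<open>0\<close>, so that
  \<open>[0, s]\<close> and \<open>(0, s]\<close> have the same mass. The mean number of visits satisfies this because the
  perturbed walk is almost surely positive.
\<close>

locale stieltjes_function =
  fixes F :: "real \<Rightarrow> real"
  assumes mono_F: "x \<le> y \<Longrightarrow> F x \<le> F y"
    and right_cont_F: "continuous (at_right a) F"
    and F_eq_0: "x \<le> 0 \<Longrightarrow> F x = 0"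
begin

sublocale mu: sigma_finite_measure "interval_measure F"
  using mono_F right_cont_F by (rule sigma_finite_interval_measure)

lemma F_nonneg: "0 \<le> F x"
  using mono_F[of 0 x] F_eq_0[of 0] F_eq_0[of x] by linarith

lemma emeasure_interval_measure_Icc_0:
  assumes "0 \<le> s"
  shows "emeasure (interval_measure F) {0..s} = ennreal (F s)"
proof -
  have "emeasure (interval_measure F) {0} \<le> emeasure (interval_measure F) {-1<..0}"
    by (rule emeasure_mono) auto
  also have "\<dots> = 0"
    by (subst emeasure_interval_measure_Ioc[OF _ mono_F right_cont_F]) (auto simp: F_eq_0)
  finally have "emeasure (interval_measure F) {0} = 0"
    by simp
  then have "emeasure (interval_measure F) ({0<..s} \<union> {0}) = emeasure (interval_measure F) {0<..s}"
    by (intro emeasure_Un_null_set) auto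
  also have "{0<..s} \<union> {0} = {0..s}"
    using assms by auto
  finally show ?thesis
    using assms by (simp add: emeasure_interval_measure_Ioc[OF assms mono_F right_cont_F] F_eq_0)
qed

text \<open>
  The integrand is at most \<open>f t\<close> on an interval of mass \<open>F t\<close>, so the Lebesgue integral is a
  genuine one and equals the nonnegative integral. The estimates below are made for the latter,
  to which Tonelli's theorem applies directly.
\<close>

lemma stieltjes_conv_eq_nn_integral:
  fixes f :: "real \<Rightarrow> real"
  assumes "mono f" and f0: "\<And>x. x < 0 \<Longrightarrow> f x = 0"
  shows "ennreal (LINT y:{0..t}|interval_measure F. f (t - y)) =
     (\<integral>\<^sup>+y. ennreal (f (t - y)) * indicator {0..t} y \<partial>interval_measure F)"
proof -
  have [measurable]: "f \<in> borel_measurable borel"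
    using \<open>mono f\<close> by (rule borel_measurable_mono)
  have nonneg: "0 \<le> f x" for x
    using monoD[OF \<open>mono f\<close>, of "min (-1) x" x] f0[of "min (-1) x"] by auto
  have "(\<integral>\<^sup>+y. ennreal (f (t - y)) * indicator {0..t} y \<partial>interval_measure F)
      \<le> (\<integral>\<^sup>+y. ennreal (f t) * indicator {0..t} y \<partial>interval_measure F)"
    by (intro nn_integral_mono) (auto split: split_indicator intro!: ennreal_leI monoD[OF \<open>mono f\<close>])
  also have "\<dots> = ennreal (f t) * emeasure (interval_measure F) {0..t}"
    by (simp add: nn_integral_cmult_indicator)
  also have "\<dots> < \<infinity>"
    using emeasure_interval_measure_Icc_0[of t]
    by (cases "0 \<le> t") (auto simp: ennreal_mult_less_top)
  finally have fin: "(\<integral>\<^sup>+y. ennreal (f (t - y)) * indicator {0..t} y \<partial>interval_measure F) < \<infinity>" .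
  have eq: "ennreal (indicator {0..t} y *\<^sub>R f (t - y)) = ennreal (f (t - y)) * indicator {0..t} y" for y
    by (auto split: split_indicator)
  have "integrable (interval_measure F) (\<lambda>y. indicator {0..t} y *\<^sub>R f (t - y))"
    using fin nonneg
    by (intro integrableI_nonneg) (auto simp: eq intro!: AE_I2 scaleR_nonneg_nonneg simp del: real_scaleR_def)
  then show ?thesis
    using nonneg unfolding set_lebesgue_integral_def
    by (subst nn_integral_eq_integral[symmetric]) (auto simp: eq[symmetric])
qed

lemma mono_stieltjes_conv:
  fixes f :: "real \<Rightarrow> real"
  assumes "mono f" and f0: "\<And>x. x < 0 \<Longrightarrow> f x = 0"
  shows "mono (\<lambda>t. LINT y:{0..t}|interval_measure F. f (t - y))"
proof (rule monoI)
  fix s t :: real assume "s \<le> t"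
  have nonneg: "0 \<le> f x" for x
    using monoD[OF \<open>mono f\<close>, of "min (-1) x" x] f0[of "min (-1) x"] by auto
  have "ennreal (LINT y:{0..s}|interval_measure F. f (s - y)) \<le>
      ennreal (LINT y:{0..t}|interval_measure F. f (t - y))"
    unfolding stieltjes_conv_eq_nn_integral[OF \<open>mono f\<close> f0, simplified]
  proof (intro nn_integral_mono)
    fix y
    show "ennreal (f (s - y)) * indicator {0..s} y \<le> ennreal (f (t - y)) * indicator {0..t} y"
      using \<open>s \<le> t\<close> by (auto split: split_indicator intro!: ennreal_leI monoD[OF \<open>mono f\<close>])
  qed
  then show "(LINT y:{0..s}|interval_measure F. f (s - y)) \<le>
      (LINT y:{0..t}|interval_measure F. f (t - y))"
    using nonneg unfolding set_lebesgue_integral_def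
    by (subst (asm) ennreal_le_iff) (auto intro!: integral_nonneg)
qed

text \<open>
  Monotonicity is what makes the next convolution integral measurable and finite, so it has to be
  carried along the recursion together with vanishing on the negative half-line.
\<close>

lemma conv_power_mono_zero:
  "mono (stieltjes_conv_power F (Suc n)) \<and> (\<forall>t<0. stieltjes_conv_power F (Suc n) t = 0)"
proof (induction n)
  case 0
  then show ?case
    by (auto intro!: monoI mono_F simp: F_eq_0)
next
  case (Suc n)
  then have "mono (\<lambda>t. LINT y:{0..t}|interval_measure F. stieltjes_conv_power F (Suc n) (t - y))"
    by (intro mono_stieltjes_conv) auto
  then show ?case
    by (auto simp: mono_def set_lebesgue_integral_def)
qed

lemma conv_power_nonneg: "0 \<le> stieltjes_conv_power F (Suc n) t"
  using conv_power_mono_zero[of n] monoD[of _ "min (-1) t" t] by (metis min.cobounded1 min.cobounded2 neg_less_0_iff_less order_le_less_trans zero_less_one)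

lemma conv_power_Suc_Suc:
  "ennreal (stieltjes_conv_power F (Suc (Suc n)) t) =
     (\<integral>\<^sup>+y. ennreal (stieltjes_conv_power F (Suc n) (t - y)) * indicator {0..t} y \<partial>interval_measure F)"
  using conv_power_mono_zero[of n] by (simp add: stieltjes_conv_eq_nn_integral)

text \<open>
  Writing \<open>f\<close> as the integral of its derivative and exchanging the integrals moves the convolution
  from \<open>dF\<close> to \<open>F\<close> itself. Pointwise bounds on \<open>F\<close>, which say nothing about its increments, thereby
  become bounds on the convolution.
\<close>

lemma stieltjes_conv_by_parts:
  fixes f :: "real \<Rightarrow> real" and g :: "real \<Rightarrow> ennreal" and f0 :: ennreal
  assumes [measurable]: "g \<in> borel_measurable borel"
    and f: "\<And>x. 0 \<le> x \<Longrightarrow> ennreal (f x) = f0 + (\<integral>\<^sup>+u. g u * indicator {0..x} u \<partial>lborel)"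
    and "0 \<le> s"
  shows "(\<integral>\<^sup>+y. ennreal (f (s - y)) * indicator {0..s} y \<partial>interval_measure F) =
    f0 * ennreal (F s) + (\<integral>\<^sup>+u. g u * ennreal (F (s - u)) * indicator {0..s} u \<partial>lborel)"
proof -
  interpret pair_sigma_finite "interval_measure F" "lborel :: real measure" ..
  have "(\<integral>\<^sup>+y. ennreal (f (s - y)) * indicator {0..s} y \<partial>interval_measure F) =
     (\<integral>\<^sup>+y. f0 * indicator {0..s} y + (\<integral>\<^sup>+u. g u * indicator {(u, y). 0 \<le> u \<and> 0 \<le> y \<and> u + y \<le> s} (u, y) \<partial>lborel) \<partial>interval_measure F)"
  proof (rule nn_integral_cong)
    fix y
    have "(\<integral>\<^sup>+u. g u * indicator {(u, y). 0 \<le> u \<and> 0 \<le> y \<and> u + y \<le> s} (u, y) \<partial>lborel) =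
      (\<integral>\<^sup>+u. g u * indicator {0..s - y} u \<partial>lborel) * indicator {0..s} y"
      by (subst nn_integral_multc[symmetric]) (auto intro!: nn_integral_cong split: split_indicator)
    then show "ennreal (f (s - y)) * indicator {0..s} y =
      f0 * indicator {0..s} y + (\<integral>\<^sup>+u. g u * indicator {(u, y). 0 \<le> u \<and> 0 \<le> y \<and> u + y \<le> s} (u, y) \<partial>lborel)"
      using f[of "s - y"] by (auto split: split_indicator)
  qed
  also have "\<dots> = f0 * ennreal (F s) +
     (\<integral>\<^sup>+y. (\<integral>\<^sup>+u. g u * indicator {(u, y). 0 \<le> u \<and> 0 \<le> y \<and> u + y \<le> s} (u, y) \<partial>lborel) \<partial>interval_measure F)"
    by (subst nn_integral_add)
       (auto simp: nn_integral_cmult_indicator emeasure_interval_measure_Icc_0 \<open>0 \<le> s\<close>)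
  also have "(\<integral>\<^sup>+y. (\<integral>\<^sup>+u. g u * indicator {(u, y). 0 \<le> u \<and> 0 \<le> y \<and> u + y \<le> s} (u, y) \<partial>lborel) \<partial>interval_measure F) =
     (\<integral>\<^sup>+u. (\<integral>\<^sup>+y. g u * indicator {(u, y). 0 \<le> u \<and> 0 \<le> y \<and> u + y \<le> s} (u, y) \<partial>interval_measure F) \<partial>lborel)"
    by (rule Fubini'[symmetric]) measurable
  also have "\<dots> = (\<integral>\<^sup>+u. g u * ennreal (F (s - u)) * indicator {0..s} u \<partial>lborel)"
  proof (rule nn_integral_cong)
    fix u
    have "(\<integral>\<^sup>+y. g u * indicator {(u, y). 0 \<le> u \<and> 0 \<le> y \<and> u + y \<le> s} (u, y) \<partial>interval_measure F) =
      (\<integral>\<^sup>+y. (g u * indicator {0..s} u) * indicator {0..s - u} y \<partial>interval_measure F)"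
      by (auto intro!: nn_integral_cong split: split_indicator)
    also have "\<dots> = g u * ennreal (F (s - u)) * indicator {0..s} u"
      by (subst nn_integral_cmult_indicator)
         (auto simp: emeasure_interval_measure_Icc_0 split: split_indicator)
    finally show "(\<integral>\<^sup>+y. g u * indicator {(u, y). 0 \<le> u \<and> 0 \<le> y \<and> u + y \<le> s} (u, y) \<partial>interval_measure F) =
      g u * ennreal (F (s - u)) * indicator {0..s} u" .
  qed
  finally show ?thesis .
qed

text \<open>
  Replacing \<open>F\<close> by \<open>(u + a) / m\<close> after integration by parts gives, up to a nonpositive term,
  \<open>a (s + c)\<^sup>p + (s + c)\<^sup>p\<^sup>+\<^sup>1 / (p + 1)\<close> with \<open>p = Suc n\<close>. By Bernoulli's inequality this is at
  most \<open>(s + c + a)\<^sup>p\<^sup>+\<^sup>1 / (p + 1)\<close>: the atom of mass \<open>a / m\<close> costs no more than a further shift by \<open>a\<close>.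
\<close>

lemma stieltjes_conv_power_shift_upper:
  fixes m a c s :: real
  assumes "0 < m" "0 \<le> a" "0 \<le> c" "0 \<le> s"
    and bound: "\<And>u. 0 \<le> u \<Longrightarrow> u \<le> s \<Longrightarrow> F u \<le> (u + a) / m"
  shows "(\<integral>\<^sup>+y. ennreal ((s - y + c) ^ Suc n) * indicator {0..s} y \<partial>interval_measure F)
    \<le> ennreal ((s + c + a) ^ Suc (Suc n) / (Suc (Suc n) * m))"
proof -
  let ?p = "Suc n" and ?q = "Suc (Suc n)"
  let ?g = "\<lambda>u. real ?p * (u + c) ^ n"
  have bound': "F (s - u) \<le> (s + a - u) / m" if "0 \<le> u" "u \<le> s" for u
    using bound[of "s - u"] that by (simp add: algebra_simps)
  have f: "ennreal ((x + c) ^ ?p) = ennreal (c ^ ?p) + (\<integral>\<^sup>+u. ennreal (?g u) * indicator {0..x} u \<partial>lborel)"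
    if "0 \<le> x" for x
  proof -
    have "(\<integral>\<^sup>+u. ennreal (?g u) * indicator {0..x} u \<partial>lborel) = ennreal ((x + c) ^ ?p - (0 + c) ^ ?p)"
      using assms that by (intro nn_integral_FTC_Icc) (auto intro!: derivative_eq_intros simp del: power_Suc)
    moreover have "c ^ ?p \<le> (x + c) ^ ?p"
      using assms that by (intro power_mono) auto
    ultimately show ?thesis
      using assms by (simp add: ennreal_plus[symmetric] del: ennreal_plus power_Suc)
  qed
  let ?G = "\<lambda>u. ((u + c) ^ ?p * (s + a - u) + (u + c) ^ ?q / ?q) / m"
  have "(\<integral>\<^sup>+y. ennreal ((s - y + c) ^ ?p) * indicator {0..s} y \<partial>interval_measure F) =
     ennreal (c ^ ?p) * ennreal (F s) + (\<integral>\<^sup>+u. ennreal (?g u) * ennreal (F (s - u)) * indicator {0..s} u \<partial>lborel)"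
    using f \<open>0 \<le> s\<close> by (intro stieltjes_conv_by_parts) auto
  also have "\<dots> \<le> ennreal (c ^ ?p) * ennreal ((s + a) / m) +
      (\<integral>\<^sup>+u. ennreal (?g u * ((s + a - u) / m)) * indicator {0..s} u \<partial>lborel)"
    using assms
    by (intro add_mono mult_left_mono nn_integral_mono ennreal_leI bound)
       (auto split: split_indicator intro!: mult_left_mono bound' simp: ennreal_mult'[symmetric] F_nonneg simp del: of_nat_Suc times_divide_eq_right)
  also have "(\<integral>\<^sup>+u. ennreal (?g u * ((s + a - u) / m)) * indicator {0..s} u \<partial>lborel) = ennreal (?G s - ?G 0)"
    using assms by (intro nn_integral_FTC_Icc has_derivative_power_by_parts) auto
  also have "ennreal (c ^ ?p) * ennreal ((s + a) / m) + ennreal (?G s - ?G 0) =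
    ennreal (c ^ ?p * ((s + a) / m) + (?G s - ?G 0))"
  proof -
    have "?G 0 \<le> ?G s"
      using assms
      by (intro DERIV_nonneg_imp_nondecreasing[OF \<open>0 \<le> s\<close>, of ?G])
         (auto intro!: exI has_derivative_power_by_parts simp del: power_Suc of_nat_Suc)
    then show ?thesis
      using assms by (simp add: ennreal_mult'[symmetric] ennreal_plus[symmetric] del: ennreal_plus power_Suc of_nat_Suc)
  qed
  also have "\<dots> \<le> ennreal ((s + c + a) ^ ?q / (?q * m))"
  proof (rule ennreal_leI)
    have "(s + c) ^ ?q + ?q * a * (s + c) ^ ?p \<le> (s + c + a) ^ ?q"
    proof (cases "s + c = 0")
      case True
      then show ?thesis using assms by simp
    next
      case False
      then have pos: "s + c > 0" using assms by simp
      have "1 + ?q * (a / (s + c)) \<le> (1 + a / (s + c)) ^ ?q"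
        using assms pos by (intro Bernoulli_inequality) (simp add: order_trans[OF _ divide_nonneg_pos])
      then have "(s + c) ^ ?q * (1 + ?q * (a / (s + c))) \<le> (s + c) ^ ?q * (1 + a / (s + c)) ^ ?q"
        using pos by (intro mult_left_mono) auto
      also have "\<dots> = ((s + c) * (1 + a / (s + c))) ^ ?q"
        by (rule power_mult_distrib[symmetric])
      also have "(s + c) * (1 + a / (s + c)) = s + c + a"
        using pos by (simp add: distrib_left)
      finally show ?thesis
        using pos by (simp add: distrib_left mult_ac power_Suc[of _ "Suc n"] del: of_nat_Suc power_Suc)
    qed
    moreover have "0 \<le> c ^ ?q" using assms by simp
    ultimately have "((s + c) ^ ?q + ?q * a * (s + c) ^ ?p - c ^ ?q) / ?q \<le> (s + c + a) ^ ?q / ?q"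
      by (intro divide_right_mono) auto
    then have "(s + c) ^ ?p * a + (s + c) ^ ?q / ?q - c ^ ?q / ?q \<le> (s + c + a) ^ ?q / ?q"
      by (simp add: add_divide_distrib diff_divide_distrib mult_ac del: power_Suc of_nat_Suc)
    then have "((s + c) ^ ?p * a + (s + c) ^ ?q / ?q - c ^ ?q / ?q) / m \<le> (s + c + a) ^ ?q / ?q / m"
      using \<open>0 < m\<close> by (intro divide_right_mono) auto
    then show "c ^ ?p * ((s + a) / m) + (?G s - ?G 0) \<le> (s + c + a) ^ ?q / (?q * m)"
      by (simp add: add_divide_distrib diff_divide_distrib distrib_left del: power_Suc of_nat_Suc)
  qed
  finally show ?thesis .
qed

text \<open>
  Here the comparison function \<open>(u - a)\<^sup>+ / m\<close> is Lebesgue measure started at \<open>a\<close>, and the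
  convolution with it is computed exactly.
\<close>

lemma stieltjes_conv_power_shift_lower:
  fixes m a c s :: real
  assumes "0 < m" "0 \<le> a" "0 \<le> c" "0 \<le> s"
    and bound: "\<And>u. 0 \<le> u \<Longrightarrow> u \<le> s \<Longrightarrow> (u - a) / m \<le> F u"
  shows "ennreal (max 0 (s - c - a) ^ Suc (Suc n) / (Suc (Suc n) * m)) \<le>
     (\<integral>\<^sup>+y. ennreal (max 0 (s - y - c) ^ Suc n) * indicator {0..s} y \<partial>interval_measure F)"
proof (cases "c + a \<le> s")
  case False
  then show ?thesis by simp
next
  case True
  let ?p = "Suc n" and ?q = "Suc (Suc n)"
  let ?g = "\<lambda>u. real ?p * (u + (- c)) ^ n"
  have bound': "(s - a - u) / m \<le> F (s - u)" if "c \<le> u" "u \<le> s - a" for u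
    using bound[of "s - u"] that assms by (simp add: algebra_simps)
  have f: "ennreal (max 0 (x - c) ^ ?p) = 0 + (\<integral>\<^sup>+u. (ennreal (?g u) * indicator {c..} u) * indicator {0..x} u \<partial>lborel)"
    if "0 \<le> x" for x
  proof (cases "c \<le> x")
    case True
    have "(\<integral>\<^sup>+u. (ennreal (?g u) * indicator {c..} u) * indicator {0..x} u \<partial>lborel) =
      (\<integral>\<^sup>+u. ennreal (?g u) * indicator {c..x} u \<partial>lborel)"
      using assms by (intro nn_integral_cong) (auto split: split_indicator)
    also have "\<dots> = ennreal ((x - c) ^ ?p - (c - c) ^ ?p)"
      using True by (intro nn_integral_FTC_Icc) (auto intro!: derivative_eq_intros simp del: power_Suc)
    finally show ?thesis
      using True by simp
  next
    case False
    then have "(\<integral>\<^sup>+u. (ennreal (?g u) * indicator {c..} u) * indicator {0..x} u \<partial>lborel) =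
      (\<integral>\<^sup>+u. 0 \<partial>(lborel :: real measure))"
      by (intro nn_integral_cong) (auto split: split_indicator)
    with False show ?thesis by simp
  qed
  let ?G = "\<lambda>u. ((u + (- c)) ^ ?p * (s - a - u) + (u + (- c)) ^ ?q / ?q) / m"
  have "ennreal (max 0 (s - c - a) ^ ?q / (?q * m)) = ennreal (?G (s - a) - ?G c)"
    using True by (simp add: algebra_simps del: of_nat_Suc)
  also have "\<dots> = (\<integral>\<^sup>+u. ennreal (?g u * ((s - a - u) / m)) * indicator {c..s - a} u \<partial>lborel)"
    using True assms
    by (intro nn_integral_FTC_Icc[symmetric] has_derivative_power_by_parts) auto
  also have "\<dots> \<le> (\<integral>\<^sup>+u. (ennreal (?g u) * indicator {c..} u) * ennreal (F (s - u)) * indicator {0..s} u \<partial>lborel)"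
    using assms
    by (intro nn_integral_mono)
       (auto split: split_indicator intro!: mult_left_mono bound' simp: ennreal_mult'[symmetric] F_nonneg simp del: of_nat_Suc times_divide_eq_right)
  also have "\<dots> = 0 * ennreal (F s) + \<dots>"
    by simp
  also have "\<dots> = (\<integral>\<^sup>+y. ennreal (max 0 (s - y - c) ^ ?p) * indicator {0..s} y \<partial>interval_measure F)"
    using f \<open>0 \<le> s\<close> by (intro stieltjes_conv_by_parts[symmetric]) auto
  finally show ?thesis .
qed

text \<open>
  Each convolution adds \<open>a\<close> to the shift and divides by \<open>Suc (Suc n) * m\<close>. The assumption on \<open>F\<close>
  is made on \<open>[0, t]\<close> with one constant \<open>a\<close>, since the convolution at \<open>s\<close> looks at all of \<open>[0, s]\<close>.
\<close>

lemma conv_power_upper: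
  fixes m a s t :: real
  assumes "0 < m" "0 \<le> a" "0 \<le> s" "s \<le> t"
    and bound: "\<And>u. 0 \<le> u \<Longrightarrow> u \<le> t \<Longrightarrow> F u \<le> (u + a) / m"
  shows "stieltjes_conv_power F (Suc n) s \<le> (s + Suc n * a) ^ Suc n / (m ^ Suc n * fact (Suc n))"
  using \<open>0 \<le> s\<close> \<open>s \<le> t\<close>
proof (induction n arbitrary: s)
  case 0
  then show ?case
    using bound by simp
next
  case (Suc n)
  let ?p = "Suc n" and ?q = "Suc (Suc n)"
  have fact_m: "m ^ ?q * fact ?q = (m ^ ?p * fact ?p) * (?q * m)"
    by (simp add: fact_Suc[of "Suc n"] del: fact_Suc of_nat_Suc)
  have "ennreal (stieltjes_conv_power F ?q s) =
     (\<integral>\<^sup>+y. ennreal (stieltjes_conv_power F ?p (s - y)) * indicator {0..s} y \<partial>interval_measure F)"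
    by (rule conv_power_Suc_Suc)
  also have "\<dots> \<le> (\<integral>\<^sup>+y. ennreal (1 / (m ^ ?p * fact ?p)) * (ennreal ((s - y + ?p * a) ^ ?p) * indicator {0..s} y) \<partial>interval_measure F)"
  proof (intro nn_integral_mono)
    fix y
    show "ennreal (stieltjes_conv_power F ?p (s - y)) * indicator {0..s} y \<le>
       ennreal (1 / (m ^ ?p * fact ?p)) * (ennreal ((s - y + ?p * a) ^ ?p) * indicator {0..s} y)"
    proof (cases "y \<in> {0..s}")
      case True
      then show ?thesis
        using Suc.IH[of "s - y"] Suc.prems \<open>0 < m\<close>
        by (simp add: ennreal_mult'[symmetric] ennreal_leI del: power_Suc of_nat_Suc fact_Suc stieltjes_conv_power.simps)
    qed simp
  qed
  also have "\<dots> = ennreal (1 / (m ^ ?p * fact ?p)) *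
      (\<integral>\<^sup>+y. ennreal ((s - y + ?p * a) ^ ?p) * indicator {0..s} y \<partial>interval_measure F)"
    by (rule nn_integral_cmult) measurable
  also have "\<dots> \<le> ennreal (1 / (m ^ ?p * fact ?p)) * ennreal ((s + ?p * a + a) ^ ?q / (?q * m))"
    using Suc.prems assms by (intro mult_left_mono stieltjes_conv_power_shift_upper) auto
  also have "\<dots> = ennreal ((s + ?q * a) ^ ?q / (m ^ ?q * fact ?q))"
    using assms
    by (simp add: ennreal_mult'[symmetric] fact_m distrib_right add_ac del: power_Suc of_nat_Suc fact_Suc)
       (simp add: algebra_simps)
  finally show ?case
    using Suc.prems assms by (subst (asm) ennreal_le_iff) (auto simp del: stieltjes_conv_power.simps)
qed

lemma conv_power_lower:
  fixes m a s t :: real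
  assumes "0 < m" "0 \<le> a" "0 \<le> s" "s \<le> t"
    and bound: "\<And>u. 0 \<le> u \<Longrightarrow> u \<le> t \<Longrightarrow> (u - a) / m \<le> F u"
  shows "max 0 (s - Suc n * a) ^ Suc n / (m ^ Suc n * fact (Suc n)) \<le> stieltjes_conv_power F (Suc n) s"
  using \<open>0 \<le> s\<close> \<open>s \<le> t\<close>
proof (induction n arbitrary: s)
  case 0
  then show ?case
    using bound[of s] F_nonneg[of s] by (auto simp: max_def)
next
  case (Suc n)
  let ?p = "Suc n" and ?q = "Suc (Suc n)"
  have fact_m: "m ^ ?q * fact ?q = (m ^ ?p * fact ?p) * (?q * m)"
    by (simp add: fact_Suc[of "Suc n"] del: fact_Suc of_nat_Suc)
  have "ennreal (max 0 (s - ?q * a) ^ ?q / (m ^ ?q * fact ?q)) =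
      ennreal (1 / (m ^ ?p * fact ?p)) * ennreal (max 0 (s - ?p * a - a) ^ ?q / (?q * m))"
    using assms
    by (simp add: ennreal_mult'[symmetric] fact_m distrib_right diff_diff_eq del: power_Suc of_nat_Suc fact_Suc)
       (simp add: algebra_simps)
  also have "\<dots> \<le> ennreal (1 / (m ^ ?p * fact ?p)) *
      (\<integral>\<^sup>+y. ennreal (max 0 (s - y - ?p * a) ^ ?p) * indicator {0..s} y \<partial>interval_measure F)"
    using Suc.prems assms by (intro mult_left_mono stieltjes_conv_power_shift_lower) auto
  also have "\<dots> = (\<integral>\<^sup>+y. ennreal (1 / (m ^ ?p * fact ?p)) * (ennreal (max 0 (s - y - ?p * a) ^ ?p) * indicator {0..s} y) \<partial>interval_measure F)"
    by (rule nn_integral_cmult[symmetric]) measurable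
  also have "\<dots> \<le> (\<integral>\<^sup>+y. ennreal (stieltjes_conv_power F ?p (s - y)) * indicator {0..s} y \<partial>interval_measure F)"
  proof (intro nn_integral_mono)
    fix y
    show "ennreal (1 / (m ^ ?p * fact ?p)) * (ennreal (max 0 (s - y - ?p * a) ^ ?p) * indicator {0..s} y) \<le>
      ennreal (stieltjes_conv_power F ?p (s - y)) * indicator {0..s} y"
    proof (cases "y \<in> {0..s}")
      case True
      then show ?thesis
        using Suc.IH[of "s - y"] Suc.prems \<open>0 < m\<close>
        by (simp add: ennreal_mult'[symmetric] ennreal_leI del: power_Suc of_nat_Suc fact_Suc stieltjes_conv_power.simps)
    qed simp
  qed
  also have "\<dots> = ennreal (stieltjes_conv_power F ?q s)"
    by (rule conv_power_Suc_Suc[symmetric])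
  finally show ?case
    using conv_power_nonneg by (subst (asm) ennreal_le_iff) (auto simp del: stieltjes_conv_power.simps)
qed

text \<open>
  The two bounds give \<open>1 - x \<le> \<rho> \<le> exp x\<close> for the ratio \<open>\<rho>\<close> of the two sides and
  \<open>x = j\<^sup>2 a / t\<close>: the lower one by Bernoulli's inequality, the upper one by \<open>1 + y \<le> exp y\<close>.
\<close>

lemma conv_power_asymp_equiv:
  fixes a :: "real \<Rightarrow> real" and j :: "real \<Rightarrow> nat"
  assumes "0 < m"
    and lin: "\<forall>\<^sub>F t in at_top. \<forall>s\<in>{0..t}. \<bar>m * F s - s\<bar> \<le> a t"
    and j_pos: "\<forall>\<^sub>F t in at_top. 1 \<le> j t"
    and small: "((\<lambda>t. (real (j t))\<^sup>2 * (a t / t)) \<longlongrightarrow> 0) at_top"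
  shows "(\<lambda>t. stieltjes_conv_power F (j t) t) \<sim>[at_top] (\<lambda>t. t ^ j t / (m ^ j t * fact (j t)))"
proof (rule asymp_equivI')
  let ?x = "\<lambda>t. (real (j t))\<^sup>2 * (a t / t)"
  let ?\<rho> = "\<lambda>t. stieltjes_conv_power F (j t) t / (t ^ j t / (m ^ j t * fact (j t)))"
  have "\<forall>\<^sub>F t in at_top. 1 - ?x t \<le> ?\<rho> t \<and> ?\<rho> t \<le> exp (?x t)"
    using lin j_pos eventually_gt_at_top[of 0]
  proof eventually_elim
    case (elim t)
    obtain n where n: "j t = Suc n"
      using elim(2) by (cases "j t") auto
    have bound: "\<bar>m * F s - s\<bar> \<le> a t" if "0 \<le> s" "s \<le> t" for s
      using elim(1) that by auto
    have a: "0 \<le> a t"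
      using bound[of 0] elim(3) by linarith
    \<comment> \<open>the relative shift: \<open>t \<plusminus> j a = t (1 \<plusminus> y)\<close>\<close>
    define y where "y = Suc n * (a t / t)"
    have "0 \<le> y"
      unfolding y_def using a elim(3) by (intro mult_nonneg_nonneg) auto
    have x: "?x t = Suc n * y"
      by (simp add: n y_def power2_eq_square mult.assoc)
    have D: "0 < t ^ Suc n" "0 < m ^ Suc n * fact (Suc n)"
      using elim(3) \<open>0 < m\<close> by (auto simp del: fact_Suc)
    have "stieltjes_conv_power F (Suc n) t \<le> (t + Suc n * a t) ^ Suc n / (m ^ Suc n * fact (Suc n))"
    proof (rule conv_power_upper[OF \<open>0 < m\<close> a])
      show "F u \<le> (u + a t) / m" if "0 \<le> u" "u \<le> t" for u
        using bound[OF that] \<open>0 < m\<close> by (simp add: field_simps abs_le_iff)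
    qed (use elim in auto)
    also have "t + Suc n * a t = t * (1 + y)"
      using elim(3) by (simp add: y_def field_simps)
    also have "(t * (1 + y)) ^ Suc n / (m ^ Suc n * fact (Suc n)) =
        (1 + y) ^ Suc n * (t ^ Suc n / (m ^ Suc n * fact (Suc n)))"
      by (simp only: power_mult_distrib times_divide_eq_right mult.commute)
    finally have "?\<rho> t \<le> (1 + y) ^ Suc n"
      using D unfolding n by (subst pos_divide_le_eq) (auto simp del: fact_Suc power_Suc stieltjes_conv_power.simps)
    also have "\<dots> \<le> exp y ^ Suc n"
      using \<open>0 \<le> y\<close> by (intro power_mono exp_ge_add_one_self) auto
    also have "\<dots> = exp (?x t)"
      by (simp only: x exp_of_nat_mult)
    finally have upper: "?\<rho> t \<le> exp (?x t)" .
    have lower0: "max 0 (t - Suc n * a t) ^ Suc n / (m ^ Suc n * fact (Suc n)) \<le> stieltjes_conv_power F (Suc n) t"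
    proof (rule conv_power_lower[OF \<open>0 < m\<close> a])
      show "(u - a t) / m \<le> F u" if "0 \<le> u" "u \<le> t" for u
        using bound[OF that] \<open>0 < m\<close> by (simp add: field_simps abs_le_iff)
    qed (use elim in auto)
    have "max 0 (t - Suc n * a t) = t * max 0 (1 - y)"
      using elim(3) by (auto simp: y_def max_def field_simps)
    then have "max 0 (1 - y) ^ Suc n \<le> ?\<rho> t"
      using lower0 D unfolding n by (simp add: field_simps power_mult_distrib del: fact_Suc power_Suc stieltjes_conv_power.simps)
    moreover have "1 - ?x t \<le> max 0 (1 - y) ^ Suc n"
    \<comment> \<open>for \<open>y > 1\<close> the left-hand side is negative, since \<open>j \<ge> 1\<close>\<close>
    proof (cases "y \<le> 1")
      case True
      then have "1 + Suc n * (- y) \<le> (1 + (- y)) ^ Suc n"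
        by (intro Bernoulli_inequality) simp
      with True show ?thesis
        unfolding x by (simp del: power_Suc of_nat_Suc)
    next
      case False
      then have "1 \<le> Suc n * y"
        using mult_mono[of 1 "real (Suc n)" 1 y] by simp
      then show ?thesis
        unfolding x by (auto intro: order_trans[of _ 0])
    qed
    ultimately show ?case
      using upper by simp
  qed
  then have *: "\<forall>\<^sub>F t in at_top. 1 - ?x t \<le> ?\<rho> t" "\<forall>\<^sub>F t in at_top. ?\<rho> t \<le> exp (?x t)"
    by (auto elim: eventually_mono)
  show "(?\<rho> \<longlongrightarrow> 1) at_top"
  proof (rule tendsto_sandwich[OF *])
    show "((\<lambda>t. 1 - ?x t) \<longlongrightarrow> 1) at_top"
      using tendsto_diff[OF tendsto_const small, of 1] by simp
    show "((\<lambda>t. exp (?x t)) \<longlongrightarrow> 1) at_top"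
      using tendsto_exp[OF small] by simp
  qed
qed

end

section \<open>Steps of the perturbed random walk\<close>

locale perturbed_random_walk = prob_space M for M :: "'a measure" +
  fixes \<xi> \<eta> :: "'a \<Rightarrow> real" and X Y :: "nat \<Rightarrow> 'a \<Rightarrow> real"
  assumes xi_measurable [measurable]: "\<xi> \<in> borel_measurable M"
    and eta_measurable [measurable]: "\<eta> \<in> borel_measurable M"
    and pos: "AE \<omega> in M. \<xi> \<omega> > 0 \<and> \<eta> \<omega> > 0"
    and indep: "indep_vars (\<lambda>_. borel :: (real \<times> real) measure) (\<lambda>i \<omega>. (X i \<omega>, Y i \<omega>)) {1..}"
    and ident: "\<And>i. i \<ge> 1 \<Longrightarrow> distr M (borel :: (real \<times> real) measure) (\<lambda>\<omega>. (X i \<omega>, Y i \<omega>))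
        = distr M borel (\<lambda>\<omega>. (\<xi> \<omega>, \<eta> \<omega>))"
begin

abbreviation "S \<equiv> walk X"
abbreviation "T \<equiv> perturbed_walk X Y"

lemma walk_0 [simp]: "S 0 \<omega> = 0"
  by (simp add: walk_def)

lemma walk_Suc: "S (Suc i) \<omega> = S i \<omega> + X (Suc i) \<omega>"
  by (simp add: walk_def)

lemma perturbed_walk_Suc: "T (Suc i) \<omega> = S i \<omega> + Y (Suc i) \<omega>"
  by (simp add: perturbed_walk_def)

lemma borel_measurable_fst_snd [measurable]:
  "fst \<in> borel_measurable (borel :: (real \<times> real) measure)"
  "snd \<in> borel_measurable (borel :: (real \<times> real) measure)"
  by (simp_all add: borel_prod[symmetric])

lemma pair_measurable: "i \<ge> 1 \<Longrightarrow> (\<lambda>\<omega>. (X i \<omega>, Y i \<omega>)) \<in> measurable M borel"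
  using indep unfolding indep_vars_def2 by auto

lemma X_measurable [measurable]: "(\<lambda>\<omega>. X (Suc i) \<omega>) \<in> borel_measurable M"
  using measurable_compose[OF pair_measurable[of "Suc i"] borel_measurable_fst_snd(1)] by simp

lemma Y_measurable [measurable]: "(\<lambda>\<omega>. Y (Suc i) \<omega>) \<in> borel_measurable M"
  using measurable_compose[OF pair_measurable[of "Suc i"] borel_measurable_fst_snd(2)] by simp

lemma walk_measurable [measurable]: "S i \<in> borel_measurable M"
  by (induction i) (simp_all add: walk_Suc[abs_def] walk_0[abs_def])

lemma perturbed_walk_measurable [measurable]: "(\<lambda>\<omega>. T (Suc i) \<omega>) \<in> borel_measurable M"
  unfolding perturbed_walk_Suc by measurable

text \<open>
  The only consequence of independence that is used: \<open>S i\<close> depends on the first \<open>i\<close> pairs, so the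
  pair with index \<open>Suc i\<close> may be integrated out first, with the law of \<open>(\<xi>, \<eta>)\<close>.
\<close>

lemma nn_integral_step:
  fixes \<phi> :: "real \<times> real \<times> real \<Rightarrow> ennreal"
  assumes [measurable]: "\<phi> \<in> borel_measurable borel"
  shows "(\<integral>\<^sup>+\<omega>. \<phi> (S i \<omega>, X (Suc i) \<omega>, Y (Suc i) \<omega>) \<partial>M) =
    (\<integral>\<^sup>+\<omega>. (\<integral>\<^sup>+\<omega>'. \<phi> (S i \<omega>, \<xi> \<omega>', \<eta> \<omega>') \<partial>M) \<partial>M)"
proof -
  let ?Z = "\<lambda>i \<omega>. (X i \<omega>, Y i \<omega>)"
  \<comment> \<open>\<open>indep_var\<close> needs both variables to have the same type, so \<open>S i\<close> is padded to a pair\<close>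
  let ?W = "\<lambda>i \<omega>. (S i \<omega>, 0 :: real)"
  have "indep_var borel ((\<lambda>f. (\<Sum>k=1..i. fst (f k), 0 :: real)) \<circ> (\<lambda>\<omega>. \<lambda>k\<in>{1..i}. ?Z k \<omega>))
      borel ((\<lambda>f. f (Suc i)) \<circ> (\<lambda>\<omega>. \<lambda>k\<in>{Suc i}. ?Z k \<omega>))"
  proof (intro indep_var_compose[OF indep_var_restrict[OF indep]])
    have "(\<lambda>f. fst (f k)) \<in> borel_measurable (Pi\<^sub>M {1..i} (\<lambda>_. borel :: (real \<times> real) measure))"
      if "k \<in> {1..i}" for k
      using that by (intro measurable_compose[OF measurable_component_singleton]) auto
    then show "(\<lambda>f. (\<Sum>k=1..i. fst (f k), 0 :: real)) \<in>
        measurable (Pi\<^sub>M {1..i} (\<lambda>_. borel :: (real \<times> real) measure)) borel"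
      by (auto simp: borel_prod[symmetric])
  qed auto
  also have "((\<lambda>f. (\<Sum>k=1..i. fst (f k), 0 :: real)) \<circ> (\<lambda>\<omega>. \<lambda>k\<in>{1..i}. ?Z k \<omega>)) = ?W i"
    by (auto simp: walk_def fun_eq_iff)
  also have "((\<lambda>f. f (Suc i)) \<circ> (\<lambda>\<omega>. \<lambda>k\<in>{Suc i}. ?Z k \<omega>)) = ?Z (Suc i)"
    by auto
  finally have joint: "distr M (borel \<Otimes>\<^sub>M borel) (\<lambda>\<omega>. (?W i \<omega>, ?Z (Suc i) \<omega>)) =
      distr M borel (?W i) \<Otimes>\<^sub>M distr M borel (?Z (Suc i))"
    by (simp add: indep_var_distribution_eq)
  have [measurable]: "?Z (Suc i) \<in> measurable M borel" "(\<lambda>\<omega>. (\<xi> \<omega>, \<eta> \<omega>)) \<in> measurable M borel"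
    using pair_measurable[of "Suc i"] by (auto simp: borel_prod[symmetric])
  have [measurable]: "?W i \<in> measurable M borel"
    by (auto simp: borel_prod[symmetric])
  have [measurable]: "(\<lambda>(w :: real \<times> real, z). \<phi> (fst w, z)) \<in> borel_measurable (borel \<Otimes>\<^sub>M borel)"
    using assms by (simp add: borel_prod[symmetric])
  have [measurable]: "\<phi> \<in> borel_measurable (borel \<Otimes>\<^sub>M (borel \<Otimes>\<^sub>M borel))"
    using assms by (simp add: borel_prod)
  interpret D: prob_space "distr M borel (\<lambda>\<omega>. (\<xi> \<omega>, \<eta> \<omega>))"
    by (rule prob_space_distr) measurable
  have "(\<integral>\<^sup>+\<omega>. \<phi> (S i \<omega>, ?Z (Suc i) \<omega>) \<partial>M) =
      (\<integral>\<^sup>+v. (\<lambda>(w, z). \<phi> (fst w, z)) v \<partial>distr M (borel \<Otimes>\<^sub>M borel) (\<lambda>\<omega>. (?W i \<omega>, ?Z (Suc i) \<omega>)))"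
    by (subst nn_integral_distr) simp_all
  also have "\<dots> = (\<integral>\<^sup>+v. (\<lambda>(w, z). \<phi> (fst w, z)) v \<partial>(distr M borel (?W i) \<Otimes>\<^sub>M distr M borel (\<lambda>\<omega>. (\<xi> \<omega>, \<eta> \<omega>))))"
    by (simp add: joint ident)
  also have "\<dots> = (\<integral>\<^sup>+w. (\<integral>\<^sup>+z. \<phi> (fst w, z) \<partial>distr M borel (\<lambda>\<omega>. (\<xi> \<omega>, \<eta> \<omega>))) \<partial>distr M borel (?W i))"
    by (subst D.nn_integral_fst[symmetric]) simp_all
  also have "\<dots> = (\<integral>\<^sup>+w. (\<integral>\<^sup>+\<omega>'. \<phi> (fst w, \<xi> \<omega>', \<eta> \<omega>') \<partial>M) \<partial>distr M borel (?W i))"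
    by (intro nn_integral_cong nn_integral_distr) (simp_all add: borel_prod[symmetric])
  also have "\<dots> = (\<integral>\<^sup>+\<omega>. (\<integral>\<^sup>+\<omega>'. \<phi> (S i \<omega>, \<xi> \<omega>', \<eta> \<omega>') \<partial>M) \<partial>M)"
    by (subst nn_integral_distr) (auto simp: borel_prod[symmetric])
  finally show ?thesis .
qed

lemma AE_step_pos: "AE \<omega> in M. \<forall>i. 0 < X (Suc i) \<omega> \<and> 0 < Y (Suc i) \<omega>"
  unfolding AE_all_countable
proof
  fix i
  have sets: "{z :: real \<times> real. 0 < fst z \<and> 0 < snd z} \<in> sets borel"
  proof -
    have "Measurable.pred borel (\<lambda>z :: real \<times> real. 0 < fst z \<and> 0 < snd z)"
      by measurable
    then show ?thesis
      by (simp add: pred_def)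
  qed
  have [measurable]: "(\<lambda>\<omega>. (\<xi> \<omega>, \<eta> \<omega>)) \<in> measurable M borel"
    by (auto simp: borel_prod[symmetric])
  have "AE z in distr M borel (\<lambda>\<omega>. (\<xi> \<omega>, \<eta> \<omega>)). 0 < fst z \<and> 0 < snd z"
    using pos by (subst AE_distr_iff) (auto simp: sets)
  then have "AE z in distr M borel (\<lambda>\<omega>. (X (Suc i) \<omega>, Y (Suc i) \<omega>)). 0 < fst z \<and> 0 < snd z"
    by (subst ident) simp_all
  then show "AE \<omega> in M. 0 < X (Suc i) \<omega> \<and> 0 < Y (Suc i) \<omega>"
    using pair_measurable[of "Suc i"] by (subst (asm) AE_distr_iff) (auto simp: sets)
qed

lemma AE_walk_nonneg: "AE \<omega> in M. 0 \<le> S i \<omega>"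
  using AE_step_pos
proof eventually_elim
  case (elim \<omega>)
  show ?case
    unfolding walk_def using elim by (intro sum_nonneg) (metis Suc_le_D atLeastAtMost_iff less_imp_le One_nat_def)
qed

section \<open>Sums over the renewal process\<close>

text \<open>
  Let \<open>f\<close> be the primitive of \<open>u \<mapsto> h ((t - u)\<^sup>+)\<close>, stopped at \<open>t + 1\<close>. The integrand is increasing,
  so a step of size \<open>x\<close> from \<open>s \<le> t\<close> raises \<open>f\<close> by at least \<open>min x 1 * h (t - s)\<close>; the margin
  from \<open>t\<close> to \<open>t + 1\<close> leaves room for a step of size at most \<open>1\<close> from the last point. As the step
  is independent of the position, the expected total increase of \<open>f\<close> along the walk is at least
  the left-hand side, and it is at most the supremum of \<open>f\<close>, which is the right-hand side.
\<close>

lemma renewal_sum_bound: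
  fixes h :: "real \<Rightarrow> ennreal"
  assumes [measurable]: "h \<in> borel_measurable borel"
    and anti: "\<And>x y. 0 \<le> x \<Longrightarrow> x \<le> y \<Longrightarrow> h y \<le> h x"
    and "0 \<le> t"
  shows "(\<integral>\<^sup>+\<omega>. ennreal (min (\<xi> \<omega>) 1) \<partial>M) *
      (\<Sum>i. \<integral>\<^sup>+\<omega>. h (t - S i \<omega>) * indicator {..t} (S i \<omega>) \<partial>M)
    \<le> h 0 + (\<integral>\<^sup>+u. h u * indicator {0..t} u \<partial>lborel)"
proof -
  let ?c = "\<integral>\<^sup>+\<omega>. ennreal (min (\<xi> \<omega>) 1) \<partial>M"
  let ?e = "\<lambda>i. \<integral>\<^sup>+\<omega>. h (t - S i \<omega>) * indicator {..t} (S i \<omega>) \<partial>M"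
  let ?B = "h 0 + (\<integral>\<^sup>+u. h u * indicator {0..t} u \<partial>lborel)"
  define f where "f s = (\<integral>\<^sup>+u. (if 0 \<le> u \<and> u \<le> s \<and> u \<le> t + 1 then h (max 0 (t - u)) else 0) \<partial>lborel)" for s
  have [measurable]: "f \<in> borel_measurable borel"
    unfolding f_def by measurable
  have f_le: "f s \<le> ?B" for s
  proof -
    have "f s \<le> (\<integral>\<^sup>+u. h 0 * indicator {t<..t + 1} u + h (t - u) * indicator {0..t} (t - u) \<partial>lborel)"
      unfolding f_def by (intro nn_integral_mono) (auto split: split_indicator simp: max_def)
    also have "\<dots> = h 0 + (\<integral>\<^sup>+u. h (t - u) * indicator {0..t} (t - u) \<partial>lborel)"
      by (subst nn_integral_add) (auto simp: nn_integral_cmult_indicator)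
    also have "(\<integral>\<^sup>+u. h (t - u) * indicator {0..t} (t - u) \<partial>lborel) =
        (\<integral>\<^sup>+u. h u * indicator {0..t} u \<partial>lborel)"
      using nn_integral_real_affine[of "\<lambda>u. h u * indicator {0..t} u" "-1" t] by simp
    finally show ?thesis .
  qed
  \<comment> \<open>if \<open>s \<le> t\<close>, the integrand of \<open>f\<close> is at least \<open>h (t - s)\<close> on \<open>(s, s + min x 1]\<close>, which lies below \<open>t + 1\<close>\<close>
  have f_step: "f s + ennreal (min x 1) * (h (t - s) * indicator {..t} s) \<le> f (s + x)"
    if "0 \<le> s" "0 \<le> x" for s x
  proof (cases "s \<le> t")
    case False
    then show ?thesis
      using that unfolding f_def by (auto intro!: nn_integral_mono)
  next
    case True
    have "f s + ennreal (min x 1) * (h (t - s) * indicator {..t} s) =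
       (\<integral>\<^sup>+u. (if 0 \<le> u \<and> u \<le> s \<and> u \<le> t + 1 then h (max 0 (t - u)) else 0)
          + h (t - s) * indicator {s<..s + min x 1} u \<partial>lborel)"
      unfolding f_def using True that
      by (subst nn_integral_add) (auto simp: nn_integral_cmult_indicator mult.commute)
    also have "\<dots> \<le> f (s + x)"
      unfolding f_def using True that
      by (intro nn_integral_mono) (auto split: split_indicator intro!: anti)
    finally show ?thesis .
  qed
  have step: "(\<integral>\<^sup>+\<omega>. f (S i \<omega>) \<partial>M) + ?c * ?e i \<le> (\<integral>\<^sup>+\<omega>. f (S (Suc i) \<omega>) \<partial>M)" for i
  proof -
    let ?\<phi> = "\<lambda>(s, x, y :: real). ennreal (min x 1) * (h (t - s) * indicator {..t} s)"
    have "(\<integral>\<^sup>+\<omega>. ?\<phi> (S i \<omega>, X (Suc i) \<omega>, Y (Suc i) \<omega>) \<partial>M) =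
        (\<integral>\<^sup>+\<omega>. (\<integral>\<^sup>+\<omega>'. ?\<phi> (S i \<omega>, \<xi> \<omega>', \<eta> \<omega>') \<partial>M) \<partial>M)"
      by (rule nn_integral_step) (simp add: borel_prod[symmetric])
    then have "?c * ?e i = (\<integral>\<^sup>+\<omega>. ennreal (min (X (Suc i) \<omega>) 1) * (h (t - S i \<omega>) * indicator {..t} (S i \<omega>)) \<partial>M)"
      by (simp add: nn_integral_multc nn_integral_cmult)
    then have "(\<integral>\<^sup>+\<omega>. f (S i \<omega>) \<partial>M) + ?c * ?e i =
       (\<integral>\<^sup>+\<omega>. f (S i \<omega>) + ennreal (min (X (Suc i) \<omega>) 1) * (h (t - S i \<omega>) * indicator {..t} (S i \<omega>)) \<partial>M)"
      by (simp add: nn_integral_add)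
    also have "\<dots> \<le> (\<integral>\<^sup>+\<omega>. f (S (Suc i) \<omega>) \<partial>M)"
    proof (rule nn_integral_mono_AE)
      show "AE \<omega> in M. f (S i \<omega>) + ennreal (min (X (Suc i) \<omega>) 1) *
          (h (t - S i \<omega>) * indicator {..t} (S i \<omega>)) \<le> f (S (Suc i) \<omega>)"
        using AE_walk_nonneg[of i] AE_step_pos
      proof eventually_elim
        case (elim \<omega>)
        then show ?case
          using f_step[of "S i \<omega>" "X (Suc i) \<omega>"] by (simp add: walk_Suc less_imp_le)
      qed
    qed
    finally show ?thesis .
  qed
  have "?c * (\<Sum>i<n. ?e i) \<le> (\<integral>\<^sup>+\<omega>. f (S n \<omega>) \<partial>M)" for n
  proof (induction n)
    case (Suc n)
    have "?c * (\<Sum>i<Suc n. ?e i) = ?c * (\<Sum>i<n. ?e i) + ?c * ?e n"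
      by (simp add: distrib_left)
    also have "\<dots> \<le> (\<integral>\<^sup>+\<omega>. f (S (Suc n) \<omega>) \<partial>M)"
      using Suc step[of n] by (meson add_right_mono order_trans)
    finally show ?case .
  qed simp
  also have "(\<integral>\<^sup>+\<omega>. f (S n \<omega>) \<partial>M) \<le> (\<integral>\<^sup>+\<omega>. ?B \<partial>M)" for n
    by (intro nn_integral_mono f_le)
  also have "(\<integral>\<^sup>+\<omega>. ?B \<partial>M) = ?B"
    by (simp add: emeasure_space_1)
  finally have "?c * (\<Sum>i<n. ?e i) \<le> ?B" for n .
  then have "(\<Sum>i<n. ?c * ?e i) \<le> ?B" for n
    by (simp add: sum_distrib_left)
  then have "(\<Sum>i. ?c * ?e i) \<le> ?B"
    by (intro suminf_le_const) auto
  then show ?thesis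
    by simp
qed

abbreviation "trunc_mean \<equiv> expectation (\<lambda>\<omega>. min (\<xi> \<omega>) 1)"

lemma integrable_min_xi: "integrable M (\<lambda>\<omega>. min (\<xi> \<omega>) 1)"
  by (rule integrable_const_bound[where B=1]) (use pos in auto)

lemma trunc_mean_pos: "0 < trunc_mean"
proof -
  have "trunc_mean \<noteq> 0"
  proof
    assume "trunc_mean = 0"
    then have "AE \<omega> in M. min (\<xi> \<omega>) 1 = 0"
      using integrable_min_xi pos by (subst (asm) integral_nonneg_eq_0_iff_AE) auto
    with pos have "AE \<omega> in M. False"
      by eventually_elim auto
    then show False by simp
  qed
  moreover have "0 \<le> trunc_mean"
    using pos by (intro integral_nonneg_AE) auto
  ultimately show ?thesis by simp
qed

lemma integrable_renewal_term:
  fixes h :: "real \<Rightarrow> real"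
  assumes [measurable]: "h \<in> borel_measurable borel"
    and nonneg: "\<And>x. 0 \<le> h x"
    and anti: "\<And>x y. 0 \<le> x \<Longrightarrow> x \<le> y \<Longrightarrow> h y \<le> h x"
  shows "integrable M (\<lambda>\<omega>. h (t - S i \<omega>) * indicator {..t} (S i \<omega>))"
  by (rule integrable_const_bound[where B="h 0"]) (auto intro!: AE_I2 split: split_indicator simp: nonneg anti)

lemma renewal_sum_bound_real:
  fixes h :: "real \<Rightarrow> real"
  assumes [measurable]: "h \<in> borel_measurable borel"
    and nonneg: "\<And>x. 0 \<le> h x"
    and anti: "\<And>x y. 0 \<le> x \<Longrightarrow> x \<le> y \<Longrightarrow> h y \<le> h x"
    and "0 \<le> t" "0 \<le> J" and J: "(\<integral>\<^sup>+u. ennreal (h u) * indicator {0..t} u \<partial>lborel) \<le> ennreal J"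
  shows "summable (\<lambda>i. expectation (\<lambda>\<omega>. h (t - S i \<omega>) * indicator {..t} (S i \<omega>)))" (is "summable ?e")
    and "(\<Sum>i. expectation (\<lambda>\<omega>. h (t - S i \<omega>) * indicator {..t} (S i \<omega>))) \<le> (h 0 + J) / trunc_mean"
proof -
  have e: "(\<integral>\<^sup>+\<omega>. ennreal (h (t - S i \<omega>)) * indicator {..t} (S i \<omega>) \<partial>M) = ennreal (?e i)" for i
    using integrable_renewal_term[of h t i] nonneg anti
    by (subst nn_integral_eq_integral[symmetric]) (auto intro!: nn_integral_cong split: split_indicator)
  have e_nonneg: "0 \<le> ?e i" for i
    by (intro Bochner_Integration.integral_nonneg) (simp add: nonneg)
  have c: "(\<integral>\<^sup>+\<omega>. ennreal (min (\<xi> \<omega>) 1) \<partial>M) = ennreal trunc_mean"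
    using integrable_min_xi pos by (intro nn_integral_eq_integral) auto
  have "ennreal trunc_mean * (\<Sum>i. ennreal (?e i)) \<le> ennreal (h 0) + (\<integral>\<^sup>+u. ennreal (h u) * indicator {0..t} u \<partial>lborel)"
    using renewal_sum_bound[of "\<lambda>x. ennreal (h x)" t] anti \<open>0 \<le> t\<close> unfolding e c by (auto simp: ennreal_leI)
  also have "\<dots> \<le> ennreal (h 0) + ennreal J"
    by (intro add_left_mono J)
  also have "\<dots> = ennreal (h 0 + J)"
    using nonneg \<open>0 \<le> J\<close> by simp
  finally have le: "ennreal trunc_mean * (\<Sum>i. ennreal (?e i)) \<le> ennreal (h 0 + J)" .
  then have "(\<Sum>i. ennreal (?e i)) \<noteq> \<top>"
    using trunc_mean_pos by (auto simp: ennreal_mult_top top_unique)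
  then show summ: "summable ?e"
    using e_nonneg by (intro summable_suminf_not_top) auto
  have suminf_eq: "(\<Sum>i. ennreal (?e i)) = ennreal (\<Sum>i. ?e i)"
    by (intro suminf_ennreal_eq e_nonneg summable_sums summ)
  have "ennreal (trunc_mean * (\<Sum>i. ?e i)) \<le> ennreal (h 0 + J)"
    using le suminf_eq trunc_mean_pos by (simp add: ennreal_mult' less_imp_le)
  then have "trunc_mean * (\<Sum>i. ?e i) \<le> h 0 + J"
    using nonneg[of 0] \<open>0 \<le> J\<close> by (subst (asm) ennreal_le_iff) auto
  then show "suminf ?e \<le> (h 0 + J) / trunc_mean"
    using trunc_mean_pos by (simp add: field_simps)
qed

lemma expectation_indicator_atMost:
  fixes Z :: "'a \<Rightarrow> real"
  assumes [measurable]: "Z \<in> borel_measurable M"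
  shows "expectation (\<lambda>\<omega>. indicator {..t} (Z \<omega>) :: real) = prob {\<omega> \<in> space M. Z \<omega> \<le> t}"
proof -
  have "expectation (\<lambda>\<omega>. indicator {..t} (Z \<omega>) :: real) = expectation (indicator {\<omega> \<in> space M. Z \<omega> \<le> t})"
    by (intro Bochner_Integration.integral_cong) (auto split: split_indicator)
  also have "\<dots> = prob {\<omega> \<in> space M. Z \<omega> \<le> t}"
    by simp
  finally show ?thesis .
qed

lemma nn_integral_indicator_atMost:
  fixes Z :: "'a \<Rightarrow> real"
  assumes [measurable]: "Z \<in> borel_measurable M"
  shows "(\<integral>\<^sup>+\<omega>. indicator {..t} (Z \<omega>) \<partial>M) = ennreal (prob {\<omega> \<in> space M. Z \<omega> \<le> t})"
proof -
  have "(\<integral>\<^sup>+\<omega>. indicator {..t} (Z \<omega>) \<partial>M) = (\<integral>\<^sup>+\<omega>. indicator {\<omega> \<in> space M. Z \<omega> \<le> t} \<omega> \<partial>M)"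
    by (intro nn_integral_cong) (auto split: split_indicator)
  then show ?thesis by (simp add: emeasure_eq_measure)
qed

text \<open>
  The renewal function is finite: the case \<open>h = 1\<close> of the bound on renewal sums.
\<close>

lemma summable_prob_walk_le: "summable (\<lambda>i. prob {\<omega> \<in> space M. S i \<omega> \<le> t})"
proof (cases "0 \<le> t")
  case True
  then show ?thesis
    using renewal_sum_bound_real(1)[of "\<lambda>_. 1" t t] by (simp add: expectation_indicator_atMost)
next
  case False
  have "prob {\<omega> \<in> space M. S i \<omega> \<le> t} = 0" for i
    using AE_walk_nonneg[of i] False
    by (subst prob_Collect_eq_0) auto
  then show ?thesis by simp
qed

section \<open>Renewal function and mean number of visits\<close>

abbreviation "excess x \<equiv> expectation (\<lambda>\<omega>. max 0 (\<xi> \<omega> - x))"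

lemma integrable_excess: "integrable M \<xi> \<Longrightarrow> integrable M (\<lambda>\<omega>. max 0 (\<xi> \<omega> - x))"
  by simp

lemma excess_antimono:
  assumes "integrable M \<xi>" "x \<le> y"
  shows "excess y \<le> excess x"
  using assms by (intro integral_mono) auto

lemma excess_measurable [measurable]: "(\<lambda>x. excess x) \<in> borel_measurable borel"
  by measurable

lemma integrable_min_walk:
  assumes "0 \<le> t"
  shows "integrable M (\<lambda>\<omega>. min (S i \<omega>) t)"
proof (rule integrable_const_bound[where B=t])
  show "AE \<omega> in M. norm (min (S i \<omega>) t) \<le> t"
    using AE_walk_nonneg[of i] by eventually_elim (use assms in auto)
qed simp

text \<open>
  Wald's identity for a single step. For \<open>S i \<le> t\<close> the new position is the part below \<open>t\<close> plus the
  overshoot, and for \<open>S i > t\<close> nothing changes; the expected overshoot from position \<open>s\<close> is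
  \<open>excess (t - s)\<close>.
\<close>

lemma stopped_walk_step:
  assumes int: "integrable M \<xi>" and "0 \<le> t"
  shows "expectation (\<lambda>\<omega>. min (S i \<omega>) t) + expectation \<xi> * prob {\<omega> \<in> space M. S i \<omega> \<le> t} =
    expectation (\<lambda>\<omega>. min (S (Suc i) \<omega>) t) +
    expectation (\<lambda>\<omega>. excess (t - S i \<omega>) * indicator {..t} (S i \<omega>))"
proof -
  let ?m = "expectation \<xi>"
  have m_nonneg: "0 \<le> ?m"
    using pos by (intro integral_nonneg_AE) auto
  have X: "(\<integral>\<^sup>+\<omega>. ennreal (X (Suc i) \<omega>) * indicator {..t} (S i \<omega>) \<partial>M) =
      ennreal (?m * prob {\<omega> \<in> space M. S i \<omega> \<le> t})"
  proof -
    let ?\<phi> = "\<lambda>(s, x, y :: real). ennreal x * indicator {..t} s"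
    have "(\<integral>\<^sup>+\<omega>. ?\<phi> (S i \<omega>, X (Suc i) \<omega>, Y (Suc i) \<omega>) \<partial>M) =
        (\<integral>\<^sup>+\<omega>. (\<integral>\<^sup>+\<omega>'. ?\<phi> (S i \<omega>, \<xi> \<omega>', \<eta> \<omega>') \<partial>M) \<partial>M)"
      by (rule nn_integral_step) (simp add: borel_prod[symmetric])
    moreover have "(\<integral>\<^sup>+\<omega>. ennreal (\<xi> \<omega>) \<partial>M) = ennreal ?m"
      using int pos by (intro nn_integral_eq_integral) auto
    ultimately show ?thesis
      using m_nonneg
      by (simp add: nn_integral_multc nn_integral_cmult nn_integral_indicator_atMost ennreal_mult')
  qed
  have R: "(\<integral>\<^sup>+\<omega>. ennreal (max 0 (X (Suc i) \<omega> - (t - S i \<omega>))) * indicator {..t} (S i \<omega>) \<partial>M) =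
      ennreal (expectation (\<lambda>\<omega>. excess (t - S i \<omega>) * indicator {..t} (S i \<omega>)))"
  proof -
    let ?\<phi> = "\<lambda>(s, x, y :: real). ennreal (max 0 (x - (t - s))) * indicator {..t} s"
    have "(\<integral>\<^sup>+\<omega>. ?\<phi> (S i \<omega>, X (Suc i) \<omega>, Y (Suc i) \<omega>) \<partial>M) =
        (\<integral>\<^sup>+\<omega>. (\<integral>\<^sup>+\<omega>'. ?\<phi> (S i \<omega>, \<xi> \<omega>', \<eta> \<omega>') \<partial>M) \<partial>M)"
      by (rule nn_integral_step) (simp add: borel_prod[symmetric])
    moreover have "(\<integral>\<^sup>+\<omega>. ennreal (max 0 (\<xi> \<omega> - x)) \<partial>M) = ennreal (excess x)" for x
      using int by (intro nn_integral_eq_integral integrable_excess) auto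
    ultimately have "(\<integral>\<^sup>+\<omega>. ?\<phi> (S i \<omega>, X (Suc i) \<omega>, Y (Suc i) \<omega>) \<partial>M) =
        (\<integral>\<^sup>+\<omega>. ennreal (excess (t - S i \<omega>) * indicator {..t} (S i \<omega>)) \<partial>M)"
      by (simp add: nn_integral_multc ennreal_mult' ennreal_indicator)
    also have "\<dots> = ennreal (expectation (\<lambda>\<omega>. excess (t - S i \<omega>) * indicator {..t} (S i \<omega>)))"
      using int by (intro nn_integral_eq_integral integrable_renewal_term AE_I2) (auto intro: excess_antimono)
    finally show ?thesis by simp
  qed
  have E: "(\<integral>\<^sup>+\<omega>. ennreal (min (S i \<omega>) t) \<partial>M) = ennreal (expectation (\<lambda>\<omega>. min (S i \<omega>) t))"
    and E_nonneg: "0 \<le> expectation (\<lambda>\<omega>. min (S i \<omega>) t)" for i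
    using AE_walk_nonneg[of i] \<open>0 \<le> t\<close>
    by (auto intro!: nn_integral_eq_integral integral_nonneg_AE integrable_min_walk)
  have "(\<integral>\<^sup>+\<omega>. ennreal (min (S i \<omega>) t) + ennreal (X (Suc i) \<omega>) * indicator {..t} (S i \<omega>) \<partial>M) =
    (\<integral>\<^sup>+\<omega>. ennreal (min (S (Suc i) \<omega>) t) +
        ennreal (max 0 (X (Suc i) \<omega> - (t - S i \<omega>))) * indicator {..t} (S i \<omega>) \<partial>M)"
  proof (rule nn_integral_cong_AE)
    show "AE \<omega> in M. ennreal (min (S i \<omega>) t) + ennreal (X (Suc i) \<omega>) * indicator {..t} (S i \<omega>) =
      ennreal (min (S (Suc i) \<omega>) t) + ennreal (max 0 (X (Suc i) \<omega> - (t - S i \<omega>))) * indicator {..t} (S i \<omega>)"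
      using AE_walk_nonneg[of i] AE_step_pos
    proof eventually_elim
      case (elim \<omega>)
      then have "0 \<le> S i \<omega>" "0 < X (Suc i) \<omega>" by auto
      then show ?case
        using \<open>0 \<le> t\<close>
        by (auto simp: walk_Suc min_def max_def ennreal_plus[symmetric] simp del: ennreal_plus split: split_indicator)
    qed
  qed
  then have "ennreal (expectation (\<lambda>\<omega>. min (S i \<omega>) t) + ?m * prob {\<omega> \<in> space M. S i \<omega> \<le> t}) =
    ennreal (expectation (\<lambda>\<omega>. min (S (Suc i) \<omega>) t) +
      expectation (\<lambda>\<omega>. excess (t - S i \<omega>) * indicator {..t} (S i \<omega>)))"
    using m_nonneg E_nonneg by (simp add: nn_integral_add E X R[simplified])
  then show ?thesis
    using m_nonneg E_nonneg by (subst (asm) ennreal_inj) (auto intro!: add_nonneg_nonneg Bochner_Integration.integral_nonneg)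
qed

text \<open>
  Summing the one-step identities over \<open>i < n\<close> gives
  \<open>m \<Sum> P(S\<^sub>i \<le> t) = E min (S\<^sub>n, t) + \<Sum> E[excess (t - S\<^sub>i); S\<^sub>i \<le> t]\<close>. The first term on the right
  lies between \<open>t - t P(S\<^sub>n \<le> t)\<close> and \<open>t\<close>, and \<open>P(S\<^sub>n \<le> t)\<close> tends to \<open>0\<close> because it is summable.
  The second term is a renewal sum of a decreasing function with value \<open>m\<close> at \<open>0\<close>.
\<close>

lemma renewal_function_bounds:
  assumes int: "integrable M \<xi>" and "0 \<le> t" "0 \<le> J"
    and J: "(\<integral>\<^sup>+u. ennreal (excess u) * indicator {0..t} u \<partial>lborel) \<le> ennreal J"
  shows "t \<le> expectation \<xi> * (\<Sum>i. prob {\<omega> \<in> space M. S i \<omega> \<le> t})"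
    and "expectation \<xi> * (\<Sum>i. prob {\<omega> \<in> space M. S i \<omega> \<le> t}) \<le> t + (expectation \<xi> + J) / trunc_mean"
proof -
  let ?m = "expectation \<xi>"
  let ?u = "\<lambda>i. prob {\<omega> \<in> space M. S i \<omega> \<le> t}"
  let ?e = "\<lambda>i. expectation (\<lambda>\<omega>. min (S i \<omega>) t)"
  let ?r = "\<lambda>i. expectation (\<lambda>\<omega>. excess (t - S i \<omega>) * indicator {..t} (S i \<omega>))"
  have excess_0: "excess 0 = ?m"
    using pos by (intro integral_cong_AE) auto
  have r_summable: "summable ?r" and r_bound: "(\<Sum>i. ?r i) \<le> (?m + J) / trunc_mean"
    using renewal_sum_bound_real[of excess t J] excess_antimono[OF int] assms unfolding excess_0 by auto
  have r_nonneg: "0 \<le> ?r i" for i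
    by (intro Bochner_Integration.integral_nonneg) auto
  have sum_eq: "?m * (\<Sum>i<n. ?u i) = ?e n + (\<Sum>i<n. ?r i)" for n
  proof (induction n)
    case 0
    then show ?case using \<open>0 \<le> t\<close> by simp
  next
    case (Suc n)
    then show ?case
      using stopped_walk_step[OF int \<open>0 \<le> t\<close>, of n] by (simp add: distrib_left)
  qed
  have e_le: "?e n \<le> t" for n
    using integral_mono[of M "\<lambda>\<omega>. min (S n \<omega>) t" "\<lambda>_. t"] integrable_min_walk[OF \<open>0 \<le> t\<close>, of n]
    by (simp add: prob_space)
  have le_e: "t - t * ?u n \<le> ?e n" for n
  proof -
    have "expectation (\<lambda>\<omega>. t - t * indicator {..t} (S n \<omega>)) \<le> ?e n"
    proof (rule integral_mono_AE)
      show "AE \<omega> in M. t - t * indicator {..t} (S n \<omega>) \<le> min (S n \<omega>) t"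
        using AE_walk_nonneg[of n] by eventually_elim (auto split: split_indicator)
      show "integrable M (\<lambda>\<omega>. t - t * indicator {..t} (S n \<omega>))"
        by (rule integrable_const_bound[where B=t]) (use \<open>0 \<le> t\<close> in \<open>auto split: split_indicator\<close>)
    qed (rule integrable_min_walk[OF \<open>0 \<le> t\<close>])
    moreover have "integrable M (\<lambda>\<omega>. indicator {..t} (S n \<omega>) :: real)"
      by (rule integrable_const_bound[where B=1]) (auto split: split_indicator)
    ultimately show ?thesis
      by (simp add: prob_space expectation_indicator_atMost)
  qed
  have u_lim: "(\<lambda>n. ?m * (\<Sum>i<n. ?u i)) \<longlonglongrightarrow> ?m * (\<Sum>i. ?u i)"
    by (intro tendsto_mult_left summable_LIMSEQ summable_prob_walk_le)
  show "?m * (\<Sum>i. ?u i) \<le> t + (?m + J) / trunc_mean"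
  proof (rule LIMSEQ_le_const2[OF u_lim], intro exI allI impI)
    fix n
    have "(\<Sum>i<n. ?r i) \<le> (\<Sum>i. ?r i)"
      by (intro sum_le_suminf r_summable) (auto simp: r_nonneg)
    then show "?m * (\<Sum>i<n. ?u i) \<le> t + (?m + J) / trunc_mean"
      using sum_eq[of n] e_le[of n] r_bound by linarith
  qed
  have "(\<lambda>n. t - t * ?u n) \<longlonglongrightarrow> t - t * 0"
    by (intro tendsto_diff tendsto_mult_left tendsto_const summable_LIMSEQ_zero summable_prob_walk_le)
  then have "(\<lambda>n. t - t * ?u n) \<longlonglongrightarrow> t"
    by simp
  then show "t \<le> ?m * (\<Sum>i. ?u i)"
  proof (rule LIMSEQ_le[OF _ u_lim], intro exI allI impI)
    fix n
    show "t - t * ?u n \<le> ?m * (\<Sum>i<n. ?u i)"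
      using sum_eq[of n] le_e[of n] sum_nonneg[of "{..<n}" ?r] r_nonneg by force
  qed
qed

lemma AE_perturbed_walk_ge: "AE \<omega> in M. S i \<omega> \<le> T (Suc i) \<omega> \<and> 0 < T (Suc i) \<omega>"
  using AE_walk_nonneg[of i] AE_step_pos by eventually_elim (auto simp: perturbed_walk_Suc less_imp_le add_nonneg_pos)

lemma prob_perturbed_walk_le: "prob {\<omega> \<in> space M. T (Suc i) \<omega> \<le> t} \<le> prob {\<omega> \<in> space M. S i \<omega> \<le> t}"
proof (rule finite_measure_mono_AE)
  show "AE \<omega> in M. \<omega> \<in> {\<omega> \<in> space M. T (Suc i) \<omega> \<le> t} \<longrightarrow> \<omega> \<in> {\<omega> \<in> space M. S i \<omega> \<le> t}"
    using AE_perturbed_walk_ge[of i] by eventually_elim auto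
qed measurable

lemma summable_prob_perturbed_walk_le: "summable (\<lambda>i. prob {\<omega> \<in> space M. T (Suc i) \<omega> \<le> t})"
  by (rule summable_comparison_test'[OF summable_prob_walk_le[of t]])
     (simp add: prob_perturbed_walk_le)

text \<open>
  The series converges, so taking the real part of the extended expectation is harmless. The series
  also vanishes for negative \<open>t\<close>, in agreement with the case distinction in the definition.
\<close>

lemma mean_visits_eq_suminf: "mean_visits M X Y t = (\<Sum>i. prob {\<omega> \<in> space M. T (Suc i) \<omega> \<le> t})"
proof (cases "0 \<le> t")
  case True
  have "(\<integral>\<^sup>+\<omega>. visits X Y t \<omega> \<partial>M) = (\<Sum>i. ennreal (prob {\<omega> \<in> space M. T (Suc i) \<omega> \<le> t}))"
    unfolding visits_def by (subst nn_integral_suminf) (auto simp: nn_integral_indicator_atMost)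
  also have "\<dots> = ennreal (\<Sum>i. prob {\<omega> \<in> space M. T (Suc i) \<omega> \<le> t})"
    using summable_prob_perturbed_walk_le by (intro suminf_ennreal_eq summable_sums) auto
  finally show ?thesis
    using True summable_prob_perturbed_walk_le by (simp add: mean_visits_def suminf_nonneg)
next
  case False
  have "prob {\<omega> \<in> space M. T (Suc i) \<omega> \<le> t} = 0" for i
    using AE_perturbed_walk_ge[of i] False
    by (subst prob_Collect_eq_0) auto
  then show ?thesis
    using False by (simp add: mean_visits_def)
qed

text \<open>
  The walk is at most \<open>t\<close> but the perturbed walk is not precisely if \<open>S\<^sub>i \<le> t < S\<^sub>i + \<eta>\<^sub>i\<^sub>+\<^sub>1\<close>.
  Hence the difference is the renewal sum of the tail of \<open>\<eta>\<close>, whose integral over \<open>[0, t]\<close> is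
  \<open>E min (\<eta>, t)\<close>.
\<close>

lemma renewal_minus_mean_visits:
  assumes "0 \<le> t"
  shows "(\<Sum>i. prob {\<omega> \<in> space M. S i \<omega> \<le> t}) - mean_visits M X Y t
    \<le> (1 + expectation (\<lambda>\<omega>. min (\<eta> \<omega>) t)) / trunc_mean"
proof -
  define p where "p x = prob {\<omega> \<in> space M. x < \<eta> \<omega>}" for x
  let ?q = "\<lambda>i. expectation (\<lambda>\<omega>. p (t - S i \<omega>) * indicator {..t} (S i \<omega>))"
  have p_eq: "ennreal (p x) = (\<integral>\<^sup>+\<omega>. indicator {x<..} (\<eta> \<omega>) \<partial>M)" for x
  proof -
    have "(\<integral>\<^sup>+\<omega>. indicator {x<..} (\<eta> \<omega>) \<partial>M) = (\<integral>\<^sup>+\<omega>. indicator {\<omega> \<in> space M. x < \<eta> \<omega>} \<omega> \<partial>M)"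
      by (intro nn_integral_cong) (auto split: split_indicator)
    then show ?thesis by (simp add: emeasure_eq_measure p_def)
  qed
  have p_nonneg: "0 \<le> p x" and p_le_1: "p x \<le> 1" for x
    by (simp_all add: p_def)
  have p_anti: "p y \<le> p x" if "x \<le> y" for x y
    unfolding p_def using that by (intro finite_measure_mono) auto
  have "(\<lambda>x. - p x) \<in> borel_measurable borel"
    by (intro borel_measurable_mono monoI) (simp add: p_anti)
  then have [measurable]: "p \<in> borel_measurable borel"
    by simp
  have int_min: "integrable M (\<lambda>\<omega>. min (\<eta> \<omega>) t)"
    by (rule integrable_const_bound[where B=t]) (use pos \<open>0 \<le> t\<close> in auto)
  have min_nonneg: "0 \<le> expectation (\<lambda>\<omega>. min (\<eta> \<omega>) t)"
    using pos \<open>0 \<le> t\<close> by (intro integral_nonneg_AE) auto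
  interpret pair_sigma_finite M "lborel :: real measure" ..
  have "(\<integral>\<^sup>+u. ennreal (p u) * indicator {0..t} u \<partial>lborel) =
      (\<integral>\<^sup>+u. (\<integral>\<^sup>+\<omega>. (if u < \<eta> \<omega> \<and> 0 \<le> u \<and> u \<le> t then 1 else 0) \<partial>M) \<partial>lborel)"
    unfolding p_eq
    by (intro nn_integral_cong) (auto simp: nn_integral_multc[symmetric] split: split_indicator intro!: nn_integral_cong)
  also have "\<dots> = (\<integral>\<^sup>+\<omega>. (\<integral>\<^sup>+u. (if u < \<eta> \<omega> \<and> 0 \<le> u \<and> u \<le> t then 1 else 0) \<partial>lborel) \<partial>M)"
    by (rule Fubini') measurable
  also have "\<dots> \<le> (\<integral>\<^sup>+\<omega>. ennreal (min (\<eta> \<omega>) t) \<partial>M)"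
  proof (rule nn_integral_mono_AE)
    show "AE \<omega> in M. (\<integral>\<^sup>+u. (if u < \<eta> \<omega> \<and> 0 \<le> u \<and> u \<le> t then 1 else 0) \<partial>lborel) \<le> ennreal (min (\<eta> \<omega>) t)"
      using pos
    proof eventually_elim
      case (elim \<omega>)
      have "(\<integral>\<^sup>+u. (if u < \<eta> \<omega> \<and> 0 \<le> u \<and> u \<le> t then 1 else 0) \<partial>lborel) \<le>
         (\<integral>\<^sup>+u. indicator {0..min (\<eta> \<omega>) t} u \<partial>lborel)"
        by (intro nn_integral_mono) (auto split: split_indicator)
      then show ?case using elim \<open>0 \<le> t\<close> by simp
    qed
  qed
  also have "\<dots> = ennreal (expectation (\<lambda>\<omega>. min (\<eta> \<omega>) t))"
    using pos \<open>0 \<le> t\<close> by (intro nn_integral_eq_integral int_min) auto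
  finally have bound: "(\<integral>\<^sup>+u. ennreal (p u) * indicator {0..t} u \<partial>lborel) \<le> ennreal (expectation (\<lambda>\<omega>. min (\<eta> \<omega>) t))" .
  have q_summable: "summable ?q" and q_bound: "(\<Sum>i. ?q i) \<le> (p 0 + expectation (\<lambda>\<omega>. min (\<eta> \<omega>) t)) / trunc_mean"
    using renewal_sum_bound_real[OF _ _ _ \<open>0 \<le> t\<close> min_nonneg bound] p_nonneg p_anti by auto
  have split: "prob {\<omega> \<in> space M. S i \<omega> \<le> t} = prob {\<omega> \<in> space M. T (Suc i) \<omega> \<le> t} + ?q i" for i
  proof -
    have q_nonneg: "0 \<le> ?q i"
      by (intro Bochner_Integration.integral_nonneg) (simp add: p_nonneg)
    let ?\<phi> = "\<lambda>(s, x :: real, y). indicator {t - s<..} y * indicator {..t} s :: ennreal"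
    have "(\<integral>\<^sup>+\<omega>. ?\<phi> (S i \<omega>, X (Suc i) \<omega>, Y (Suc i) \<omega>) \<partial>M) =
        (\<integral>\<^sup>+\<omega>. (\<integral>\<^sup>+\<omega>'. ?\<phi> (S i \<omega>, \<xi> \<omega>', \<eta> \<omega>') \<partial>M) \<partial>M)"
      by (rule nn_integral_step) (simp add: borel_prod[symmetric] greaterThan_def)
    also have "\<dots> = (\<integral>\<^sup>+\<omega>. ennreal (p (t - S i \<omega>) * indicator {..t} (S i \<omega>)) \<partial>M)"
      by (simp add: nn_integral_multc ennreal_mult' ennreal_indicator p_nonneg p_eq[symmetric])
    also have "\<dots> = ennreal (?q i)"
      using p_nonneg p_anti by (intro nn_integral_eq_integral integrable_renewal_term AE_I2) auto
    finally have q: "ennreal (?q i) = (\<integral>\<^sup>+\<omega>. indicator {t - S i \<omega><..} (Y (Suc i) \<omega>) * indicator {..t} (S i \<omega>) \<partial>M)"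
      by simp
    have "(\<integral>\<^sup>+\<omega>. indicator {..t} (S i \<omega>) \<partial>M) =
       (\<integral>\<^sup>+\<omega>. indicator {..t} (T (Suc i) \<omega>) + indicator {t - S i \<omega><..} (Y (Suc i) \<omega>) * indicator {..t} (S i \<omega>) \<partial>M)"
    proof (rule nn_integral_cong_AE)
      show "AE \<omega> in M. (indicator {..t} (S i \<omega>) :: ennreal) =
        indicator {..t} (T (Suc i) \<omega>) + indicator {t - S i \<omega><..} (Y (Suc i) \<omega>) * indicator {..t} (S i \<omega>)"
        using AE_perturbed_walk_ge[of i]
        by eventually_elim (auto simp: perturbed_walk_Suc split: split_indicator)
    qed
    also have "\<dots> = (\<integral>\<^sup>+\<omega>. indicator {..t} (T (Suc i) \<omega>) \<partial>M) + ennreal (?q i)"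
      unfolding q by (rule nn_integral_add) (simp_all add: greaterThan_def)
    finally have "ennreal (prob {\<omega> \<in> space M. S i \<omega> \<le> t}) = ennreal (prob {\<omega> \<in> space M. T (Suc i) \<omega> \<le> t} + ?q i)"
      using q_nonneg by (simp add: nn_integral_indicator_atMost)
    then show ?thesis
      using q_nonneg by (subst (asm) ennreal_inj) auto
  qed
  have "(\<Sum>i. prob {\<omega> \<in> space M. S i \<omega> \<le> t}) = mean_visits M X Y t + (\<Sum>i. ?q i)"
    unfolding split mean_visits_eq_suminf
    by (rule suminf_add[symmetric, OF summable_prob_perturbed_walk_le q_summable])
  also have "(\<Sum>i. ?q i) \<le> (1 + expectation (\<lambda>\<omega>. min (\<eta> \<omega>) t)) / trunc_mean"
    by (rule order_trans[OF q_bound], rule divide_right_mono) (use p_le_1[of 0] trunc_mean_pos in auto)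
  finally show ?thesis by simp
qed

lemma mean_visits_le_renewal: "mean_visits M X Y t \<le> (\<Sum>i. prob {\<omega> \<in> space M. S i \<omega> \<le> t})"
  unfolding mean_visits_eq_suminf
  by (intro suminf_le prob_perturbed_walk_le summable_prob_perturbed_walk_le summable_prob_walk_le)

lemma continuous_at_right_prob_le:
  fixes Z :: "'a \<Rightarrow> real"
  assumes [measurable]: "Z \<in> borel_measurable M"
  shows "continuous (at_right a) (\<lambda>t. prob {\<omega> \<in> space M. Z \<omega> \<le> t})"
proof -
  interpret D: prob_space "distr M borel Z"
    by (rule prob_space_distr) fact
  interpret D: real_distribution "distr M borel Z"
    by unfold_locales simp_all
  have "cdf (distr M borel Z) = (\<lambda>t. prob {\<omega> \<in> space M. Z \<omega> \<le> t})"
    by (auto simp: cdf_def measure_distr fun_eq_iff intro!: arg_cong[where f=prob])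
  then show ?thesis
    using D.cdf_is_right_cont[of a] by simp
qed

text \<open>
  Right-continuity passes from the distribution functions of the \<open>T\<^sub>i\<close> to their sum by dominated
  convergence of series, the terms at \<open>a + 1\<close> being a summable bound.
\<close>

lemma stieltjes_function_mean_visits: "stieltjes_function (mean_visits M X Y)"
proof
  show "mean_visits M X Y s \<le> mean_visits M X Y t" if "s \<le> t" for s t
    unfolding mean_visits_eq_suminf using that
    by (intro suminf_le summable_prob_perturbed_walk_le finite_measure_mono) auto
next
  show "mean_visits M X Y t = 0" if "t \<le> 0" for t
  proof -
    have "prob {\<omega> \<in> space M. T (Suc i) \<omega> \<le> t} = 0" for i
      using AE_perturbed_walk_ge[of i] that
      by (subst prob_Collect_eq_0) auto
    then show ?thesis by (simp add: mean_visits_eq_suminf)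
  qed
next
  fix a :: real
  have "((\<lambda>t. \<Sum>i. prob {\<omega> \<in> space M. T (Suc i) \<omega> \<le> t}) \<longlongrightarrow>
      (\<Sum>i. prob {\<omega> \<in> space M. T (Suc i) \<omega> \<le> a})) (at_right a)"
  proof (rule tannerys_theorem[THEN conjunct2, THEN conjunct2])
    show "((\<lambda>t. prob {\<omega> \<in> space M. T (Suc i) \<omega> \<le> t}) \<longlongrightarrow> prob {\<omega> \<in> space M. T (Suc i) \<omega> \<le> a}) (at_right a)" for i
      using continuous_at_right_prob_le[of "\<lambda>\<omega>. T (Suc i) \<omega>" a] by (simp add: continuous_within)
    have "eventually (\<lambda>t. t < a + 1) (at_right a)"
      using eventually_at_right_real[of a "a + 1"] by (auto elim: eventually_mono)
    then have "eventually (\<lambda>(k, t). t < a + 1) ((at_top :: nat filter) \<times>\<^sub>F at_right a)"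
      using eventually_prodI[of "\<lambda>_ :: nat. True" at_top "\<lambda>t. t < a + 1" "at_right a"]
      by (simp add: case_prod_unfold)
    then show "eventually (\<lambda>(k, t). norm (prob {\<omega> \<in> space M. T (Suc k) \<omega> \<le> t})
        \<le> prob {\<omega> \<in> space M. T (Suc k) \<omega> \<le> a + 1}) ((at_top :: nat filter) \<times>\<^sub>F at_right a)"
      by eventually_elim (auto intro!: finite_measure_mono)
  qed (auto simp: summable_prob_perturbed_walk_le)
  then show "continuous (at_right a) (mean_visits M X Y)"
    by (simp add: continuous_within mean_visits_eq_suminf[abs_def])
qed

end

section \<open>Integrated excess under moment and tail conditions\<close>

context prob_space
begin

text \<open>
  By Fubini it suffices that the integral of \<open>(x - u)\<^sup>+\<close> over \<open>u \<in> [0, t]\<close> is at most \<open>x min (x, t)\<close>: the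
  integrand is at most \<open>x\<close> and vanishes beyond \<open>x\<close>.
\<close>

lemma nn_integral_Icc_excess_le:
  fixes \<xi> :: "'a \<Rightarrow> real"
  assumes [measurable]: "\<xi> \<in> borel_measurable M" and int: "integrable M \<xi>"
    and pos: "AE \<omega> in M. 0 \<le> \<xi> \<omega>" and "0 \<le> t"
  shows "(\<integral>\<^sup>+u. ennreal (expectation (\<lambda>\<omega>. max 0 (\<xi> \<omega> - u))) * indicator {0..t} u \<partial>lborel)
    \<le> (\<integral>\<^sup>+\<omega>. ennreal (\<xi> \<omega> * min (\<xi> \<omega>) t) \<partial>M)"
proof -
  interpret pair_sigma_finite M "lborel :: real measure" ..
  have eq: "ennreal (expectation (\<lambda>\<omega>. max 0 (\<xi> \<omega> - u))) = (\<integral>\<^sup>+\<omega>. ennreal (max 0 (\<xi> \<omega> - u)) \<partial>M)" for u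
    using int by (intro nn_integral_eq_integral[symmetric]) auto
  have "(\<integral>\<^sup>+u. ennreal (expectation (\<lambda>\<omega>. max 0 (\<xi> \<omega> - u))) * indicator {0..t} u \<partial>lborel) =
      (\<integral>\<^sup>+u. (\<integral>\<^sup>+\<omega>. (if 0 \<le> u \<and> u \<le> t then ennreal (max 0 (\<xi> \<omega> - u)) else 0) \<partial>M) \<partial>lborel)"
    by (intro nn_integral_cong) (auto simp: eq split: split_indicator)
  also have "\<dots> = (\<integral>\<^sup>+\<omega>. (\<integral>\<^sup>+u. (if 0 \<le> u \<and> u \<le> t then ennreal (max 0 (\<xi> \<omega> - u)) else 0) \<partial>lborel) \<partial>M)"
    by (rule Fubini') measurable
  also have "\<dots> \<le> (\<integral>\<^sup>+\<omega>. ennreal (\<xi> \<omega> * min (\<xi> \<omega>) t) \<partial>M)"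
  proof (rule nn_integral_mono_AE)
    show "AE \<omega> in M. (\<integral>\<^sup>+u. (if 0 \<le> u \<and> u \<le> t then ennreal (max 0 (\<xi> \<omega> - u)) else 0) \<partial>lborel) \<le>
        ennreal (\<xi> \<omega> * min (\<xi> \<omega>) t)"
      using pos
    proof eventually_elim
      case (elim \<omega>)
      have "(\<integral>\<^sup>+u. (if 0 \<le> u \<and> u \<le> t then ennreal (max 0 (\<xi> \<omega> - u)) else 0) \<partial>lborel) \<le>
          (\<integral>\<^sup>+u. ennreal (\<xi> \<omega>) * indicator {0..min (\<xi> \<omega>) t} u \<partial>lborel)"
        by (intro nn_integral_mono) (auto split: split_indicator simp: max_def intro!: ennreal_leI)
      also have "\<dots> = ennreal (\<xi> \<omega> * min (\<xi> \<omega>) t)"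
        using elim \<open>0 \<le> t\<close> by (simp add: nn_integral_cmult_indicator ennreal_mult')
      finally show ?case .
    qed
  qed
  finally show ?thesis .
qed

lemma integrable_of_powr_moment:
  fixes \<xi> :: "'a \<Rightarrow> real"
  assumes [measurable]: "\<xi> \<in> borel_measurable M"
    and pos: "AE \<omega> in M. 0 < \<xi> \<omega>" and "1 \<le> r" and r: "integrable M (\<lambda>\<omega>. \<xi> \<omega> powr r)"
  shows "integrable M \<xi>"
proof (rule Bochner_Integration.integrable_bound)
  show "integrable M (\<lambda>\<omega>. 1 + \<xi> \<omega> powr r)"
    using r by simp
  show "AE \<omega> in M. norm (\<xi> \<omega>) \<le> norm (1 + \<xi> \<omega> powr r)"
    using pos
  proof eventually_elim
    case (elim \<omega>)
    have "\<xi> \<omega> \<le> 1 + \<xi> \<omega> powr r"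
    proof (cases "\<xi> \<omega> \<le> 1")
      case True
      then show ?thesis by (simp add: add_increasing2)
    next
      case False
      then show ?thesis using powr_mono[of 1 r "\<xi> \<omega>"] \<open>1 \<le> r\<close> by simp
    qed
    then show ?case
      using elim by simp
  qed
qed simp

text \<open>
  With \<open>y = min x t\<close> one has \<open>x y = x y powr (r - 1) y powr (2 - r) \<le> x powr r t powr (2 - r)\<close>, where
  both exponents are nonnegative as \<open>1 \<le> r \<le> 2\<close>. The argument includes \<open>r = 2\<close>, where the bound
  does not grow.
\<close>

lemma excess_integral_of_powr_moment:
  fixes \<xi> :: "'a \<Rightarrow> real"
  assumes [measurable]: "\<xi> \<in> borel_measurable M"
    and pos: "AE \<omega> in M. 0 < \<xi> \<omega>" and "1 \<le> r" "r \<le> 2" and r: "integrable M (\<lambda>\<omega>. \<xi> \<omega> powr r)" and "0 < t"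
  shows "(\<integral>\<^sup>+u. ennreal (expectation (\<lambda>\<omega>. max 0 (\<xi> \<omega> - u))) * indicator {0..t} u \<partial>lborel)
    \<le> ennreal (expectation (\<lambda>\<omega>. \<xi> \<omega> powr r) * t powr (2 - r))"
proof -
  have int: "integrable M \<xi>"
    by (rule integrable_of_powr_moment[OF _ pos \<open>1 \<le> r\<close> r]) simp
  have "(\<integral>\<^sup>+u. ennreal (expectation (\<lambda>\<omega>. max 0 (\<xi> \<omega> - u))) * indicator {0..t} u \<partial>lborel)
      \<le> (\<integral>\<^sup>+\<omega>. ennreal (\<xi> \<omega> * min (\<xi> \<omega>) t) \<partial>M)"
    using pos \<open>0 < t\<close> by (intro nn_integral_Icc_excess_le int) auto
  also have "\<dots> \<le> (\<integral>\<^sup>+\<omega>. ennreal (\<xi> \<omega> powr r * t powr (2 - r)) \<partial>M)"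
  proof (rule nn_integral_mono_AE)
    show "AE \<omega> in M. ennreal (\<xi> \<omega> * min (\<xi> \<omega>) t) \<le> ennreal (\<xi> \<omega> powr r * t powr (2 - r))"
      using pos
    proof eventually_elim
      case (elim \<omega>)
      let ?x = "\<xi> \<omega>" and ?y = "min (\<xi> \<omega>) t"
      have y: "0 < ?y" using elim \<open>0 < t\<close> by simp
      have "?x * ?y = ?x * (?y powr (r - 1) * ?y powr (2 - r))"
        using y by (simp add: powr_add[symmetric])
      also have "\<dots> \<le> ?x * (?x powr (r - 1) * t powr (2 - r))"
        using y assms elim by (intro mult_left_mono mult_mono powr_mono2) auto
      also have "\<dots> = ?x powr r * t powr (2 - r)"
        using elim by (simp add: powr_diff)
      finally show ?case by (rule ennreal_leI)
    qed
  qed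
  also have "\<dots> = ennreal (expectation (\<lambda>\<omega>. \<xi> \<omega> powr r * t powr (2 - r)))"
    using r by (intro nn_integral_eq_integral) auto
  finally show ?thesis by simp
qed

text \<open>
  The expected excess is the integral of the tail over \<open>[u, \<infinity>)\<close>.
\<close>

lemma nn_integral_excess_le_of_tail:
  fixes \<xi> :: "'a \<Rightarrow> real"
  assumes [measurable]: "\<xi> \<in> borel_measurable M" and "1 < r" "0 \<le> C" "0 < u"
    and tail: "\<And>y. 0 < y \<Longrightarrow> prob {\<omega> \<in> space M. y < \<xi> \<omega>} \<le> C * y powr (- r)"
  shows "(\<integral>\<^sup>+\<omega>. ennreal (max 0 (\<xi> \<omega> - u)) \<partial>M) \<le> ennreal (C / (r - 1) * u powr (1 - r))"
proof -
  interpret pair_sigma_finite M "lborel :: real measure" ..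
  have "(\<integral>\<^sup>+\<omega>. ennreal (max 0 (\<xi> \<omega> - u)) \<partial>M) =
      (\<integral>\<^sup>+\<omega>. (\<integral>\<^sup>+y. (if u \<le> y \<and> y < \<xi> \<omega> then 1 else 0) \<partial>lborel) \<partial>M)"
  proof (rule nn_integral_cong)
    fix \<omega>
    have "(\<integral>\<^sup>+y. (if u \<le> y \<and> y < \<xi> \<omega> then 1 else 0) \<partial>lborel) = (\<integral>\<^sup>+y. indicator {u..<\<xi> \<omega>} y \<partial>lborel)"
      by (intro nn_integral_cong) (auto split: split_indicator)
    then show "ennreal (max 0 (\<xi> \<omega> - u)) = (\<integral>\<^sup>+y. (if u \<le> y \<and> y < \<xi> \<omega> then 1 else 0) \<partial>lborel)"
      by (cases "u \<le> \<xi> \<omega>") auto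
  qed
  also have "\<dots> = (\<integral>\<^sup>+y. (\<integral>\<^sup>+\<omega>. (if u \<le> y \<and> y < \<xi> \<omega> then 1 else 0) \<partial>M) \<partial>lborel)"
    by (rule Fubini'[symmetric]) measurable
  also have "\<dots> \<le> (\<integral>\<^sup>+y. ennreal (C * y powr (- r)) * indicator {u..} y \<partial>lborel)"
  proof (rule nn_integral_mono)
    fix y
    have "(\<integral>\<^sup>+\<omega>. (if y < \<xi> \<omega> then 1 else 0) \<partial>M) = (\<integral>\<^sup>+\<omega>. indicator {\<omega> \<in> space M. y < \<xi> \<omega>} \<omega> \<partial>M)"
      by (intro nn_integral_cong) (auto split: split_indicator)
    also have "\<dots> = ennreal (prob {\<omega> \<in> space M. y < \<xi> \<omega>})"
      by (simp add: emeasure_eq_measure)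
    finally show "(\<integral>\<^sup>+\<omega>. (if u \<le> y \<and> y < \<xi> \<omega> then 1 else 0) \<partial>M) \<le> ennreal (C * y powr (- r)) * indicator {u..} y"
      using tail[of y] \<open>0 < u\<close> by (cases "u \<le> y") (auto simp: ennreal_leI)
  qed
  also have "\<dots> = ennreal (0 - C * (u powr (1 - r) / (1 - r)))"
  proof (rule nn_integral_FTC_atLeast)
    show "((\<lambda>y. C * (y powr (1 - r) / (1 - r))) has_real_derivative C * y powr (- r)) (at y)" if "u \<le> y" for y
      using that \<open>0 < u\<close> \<open>1 < r\<close> by (auto intro!: derivative_eq_intros)
    have "((\<lambda>y. C * (y powr (1 - r) / (1 - r))) \<longlongrightarrow> C * (0 / (1 - r))) at_top"
      using \<open>1 < r\<close> by (intro tendsto_intros tendsto_neg_powr filterlim_ident) auto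
    then show "((\<lambda>y. C * (y powr (1 - r) / (1 - r))) \<longlongrightarrow> 0) at_top"
      by simp
  qed (use \<open>0 \<le> C\<close> in auto)
  also have "0 - C * (u powr (1 - r) / (1 - r)) = C / (r - 1) * u powr (1 - r)"
    using \<open>1 < r\<close> by (simp add: field_simps)
  finally show ?thesis .
qed

lemma integrable_of_tail:
  fixes \<xi> :: "'a \<Rightarrow> real"
  assumes [measurable]: "\<xi> \<in> borel_measurable M" and pos: "AE \<omega> in M. 0 < \<xi> \<omega>" and "1 < r" "0 \<le> C"
    and tail: "\<And>y. 0 < y \<Longrightarrow> prob {\<omega> \<in> space M. y < \<xi> \<omega>} \<le> C * y powr (- r)"
  shows "integrable M \<xi>"
proof -
  have "(\<integral>\<^sup>+\<omega>. ennreal (\<xi> \<omega>) \<partial>M) \<le> (\<integral>\<^sup>+\<omega>. 1 + ennreal (max 0 (\<xi> \<omega> - 1)) \<partial>M)"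
    by (intro nn_integral_mono)
       (auto simp: max_def ennreal_1[symmetric] ennreal_plus[symmetric] simp del: ennreal_plus ennreal_1 intro!: ennreal_leI)
  also have "\<dots> = 1 + (\<integral>\<^sup>+\<omega>. ennreal (max 0 (\<xi> \<omega> - 1)) \<partial>M)"
    by (subst nn_integral_add) (auto simp: emeasure_space_1)
  also have "\<dots> \<le> 1 + ennreal (C / (r - 1) * 1 powr (1 - r))"
    using assms by (intro add_left_mono nn_integral_excess_le_of_tail) auto
  also have "\<dots> < \<infinity>"
    by (simp add: ennreal_add_less_top)
  finally show ?thesis
    using pos by (intro integrableI_nonneg) auto
qed

text \<open>
  The bound \<open>u powr (1 - r)\<close> on the excess is integrable at \<open>0\<close> precisely because \<open>r < 2\<close>.
\<close>

lemma excess_integral_of_tail: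
  fixes \<xi> :: "'a \<Rightarrow> real"
  assumes [measurable]: "\<xi> \<in> borel_measurable M" and pos: "AE \<omega> in M. 0 < \<xi> \<omega>" and "1 < r" "r < 2" "0 \<le> C"
    and tail: "\<And>y. 0 < y \<Longrightarrow> prob {\<omega> \<in> space M. y < \<xi> \<omega>} \<le> C * y powr (- r)"
    and "0 < t"
  shows "(\<integral>\<^sup>+u. ennreal (expectation (\<lambda>\<omega>. max 0 (\<xi> \<omega> - u))) * indicator {0..t} u \<partial>lborel)
    \<le> ennreal (C / (r - 1) / (2 - r) * t powr (2 - r))"
proof -
  have int: "integrable M \<xi>"
    by (rule integrable_of_tail[OF _ pos \<open>1 < r\<close> \<open>0 \<le> C\<close> tail]) auto
  have bound: "expectation (\<lambda>\<omega>. max 0 (\<xi> \<omega> - u)) \<le> C / (r - 1) * u powr (1 - r)" if "0 < u" for u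
  proof -
    have "ennreal (expectation (\<lambda>\<omega>. max 0 (\<xi> \<omega> - u))) = (\<integral>\<^sup>+\<omega>. ennreal (max 0 (\<xi> \<omega> - u)) \<partial>M)"
      using int by (intro nn_integral_eq_integral[symmetric]) auto
    also have "\<dots> \<le> ennreal (C / (r - 1) * u powr (1 - r))"
      using assms that by (intro nn_integral_excess_le_of_tail) auto
    finally show ?thesis
      using assms by (subst (asm) ennreal_le_iff) auto
  qed
  have "(\<integral>\<^sup>+u. ennreal (expectation (\<lambda>\<omega>. max 0 (\<xi> \<omega> - u))) * indicator {0..t} u \<partial>lborel) \<le>
      (\<integral>\<^sup>+u. ennreal (C / (r - 1) * u powr (1 - r)) * indicator {0..t} u \<partial>lborel)"
  proof (rule nn_integral_mono_AE)
    show "AE u in lborel. ennreal (expectation (\<lambda>\<omega>. max 0 (\<xi> \<omega> - u))) * indicator {0..t} u \<le>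
        ennreal (C / (r - 1) * u powr (1 - r)) * indicator {0..t} u"
      using AE_lborel_singleton[of 0]
      by eventually_elim (auto split: split_indicator intro!: ennreal_leI bound simp del: times_divide_eq_left)
  qed
  also have "\<dots> = (\<integral>\<^sup>+u. ennreal (C / (r - 1) * u powr (1 - r) * indicator {0..t} u) \<partial>lborel)"
    by (intro nn_integral_cong) (auto split: split_indicator)
  also have "\<dots> = ennreal (C / (r - 1) * (t powr (1 - r + 1) / (1 - r + 1)))"
  proof (rule nn_integral_has_integral_lborel)
    have "((\<lambda>u. u powr (1 - r)) has_integral t powr (1 - r + 1) / (1 - r + 1)) {0..t}"
      using assms by (intro has_integral_powr_from_0) auto
    then have "((\<lambda>u. C / (r - 1) * u powr (1 - r)) has_integral C / (r - 1) * (t powr (1 - r + 1) / (1 - r + 1))) {0..t}"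
      by (rule has_integral_mult_right)
    then have "((\<lambda>u. if u \<in> {0..t} then C / (r - 1) * u powr (1 - r) else 0) has_integral C / (r - 1) * (t powr (1 - r + 1) / (1 - r + 1))) UNIV"
      by (simp only: has_integral_restrict_UNIV)
    then show "((\<lambda>u. C / (r - 1) * u powr (1 - r) * indicator {0..t} u) has_integral C / (r - 1) * (t powr (1 - r + 1) / (1 - r + 1))) UNIV"
      by (rule has_integral_eq[rotated]) (auto split: split_indicator)
  qed (use assms in auto)
  finally show ?thesis
    by (simp add: add.commute diff_add_eq[symmetric])
qed

text \<open>
  The asymptotic equivalence bounds the tail for large arguments only. On a bounded interval
  \<open>y powr (- r)\<close> is bounded below, so enlarging the constant makes the bound valid everywhere.
\<close>

lemma tail_bound_of_asymp_equiv:
  fixes \<xi> :: "'a \<Rightarrow> real"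
  assumes "0 < b" "0 \<le> r"
    and equiv: "(\<lambda>t. prob {\<omega> \<in> space M. t < \<xi> \<omega>}) \<sim>[at_top] (\<lambda>t. b * t powr (- r))"
  shows "\<exists>C\<ge>0. \<forall>y>0. prob {\<omega> \<in> space M. y < \<xi> \<omega>} \<le> C * y powr (- r)"
proof -
  let ?p = "\<lambda>t. prob {\<omega> \<in> space M. t < \<xi> \<omega>}"
  have "?p \<in> O[at_top](\<lambda>t. b * t powr (- r))"
    using equiv by (rule asymp_equiv_imp_bigo)
  then obtain c where "0 < c" and c: "\<forall>\<^sub>F t in at_top. norm (?p t) \<le> c * norm (b * t powr (- r))"
    by (elim landau_o.bigE)
  obtain t0 where t0: "\<And>t. t0 \<le> t \<Longrightarrow> norm (?p t) \<le> c * norm (b * t powr (- r))"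
    using c unfolding eventually_at_top_linorder by blast
  have "?p y \<le> max (c * b) (t0 powr r) * y powr (- r)" if "0 < y" for y
  proof (cases "t0 \<le> y")
    case True
    then have "?p y \<le> c * b * y powr (- r)"
      using t0[of y] \<open>0 < b\<close> by (simp add: abs_mult)
    also have "\<dots> \<le> max (c * b) (t0 powr r) * y powr (- r)"
      by (intro mult_right_mono) auto
    finally show ?thesis .
  next
    case False
    have "?p y \<le> 1" by simp
    also have "1 = y powr r * y powr (- r)"
      using that by (simp add: powr_add[symmetric])
    also have "\<dots> \<le> max (c * b) (t0 powr r) * y powr (- r)"
      using False that \<open>0 \<le> r\<close> by (intro mult_right_mono max.coboundedI2 powr_mono2) auto
    finally show ?thesis .
  qed
  then show ?thesis
    by (intro exI[of _ "max (c * b) (t0 powr r)"]) (auto simp: le_max_iff_disj)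
qed

end

section \<open>Asymptotics of the convolution powers of the mean number of visits\<close>

context perturbed_random_walk
begin

text \<open>
  The bounds on \<open>m V(s) - s\<close> increase with \<open>s\<close>, so those at the right end point serve on all of
  \<open>[0, t]\<close>. Constants are absorbed into \<open>t powr (2 - r)\<close>, which is at least \<open>1\<close> for \<open>t \<ge> 1\<close>.
\<close>

lemma mean_visits_linear:
  assumes int: "integrable M \<xi>" and "r \<le> 2" "0 \<le> C"
    and excess: "\<And>t. 0 < t \<Longrightarrow>
      (\<integral>\<^sup>+u. ennreal (excess u) * indicator {0..t} u \<partial>lborel) \<le> ennreal (C * t powr (2 - r))"
    and eta: "(\<lambda>t. expectation (\<lambda>\<omega>. min (\<eta> \<omega>) t)) \<in> O[at_top](\<lambda>t. t powr (2 - r))"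
  shows "\<exists>K\<ge>0. \<forall>\<^sub>F t in at_top. \<forall>s\<in>{0..t}. \<bar>expectation \<xi> * mean_visits M X Y s - s\<bar> \<le> K * t powr (2 - r)"
proof -
  let ?m = "expectation \<xi>" and ?c = trunc_mean
  have m_nonneg: "0 \<le> ?m"
    using pos by (intro integral_nonneg_AE) auto
  obtain B where "0 < B" and B: "\<forall>\<^sub>F t in at_top. norm (expectation (\<lambda>\<omega>. min (\<eta> \<omega>) t)) \<le> B * norm (t powr (2 - r))"
    using eta by (elim landau_o.bigE)
  let ?K = "(?m + C + ?m * (1 + B)) / ?c"
  have "\<forall>\<^sub>F t in at_top. \<forall>s\<in>{0..t}. \<bar>?m * mean_visits M X Y s - s\<bar> \<le> ?K * t powr (2 - r)"
    using B eventually_ge_at_top[of 1]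
  proof eventually_elim
    case (elim t)
    let ?p = "t powr (2 - r)"
    have p: "1 \<le> ?p"
      using elim(2) \<open>r \<le> 2\<close> by (intro ge_one_powr_ge_zero) auto
    show ?case
    proof
      fix s assume s: "s \<in> {0..t}"
      have "(\<integral>\<^sup>+u. ennreal (excess u) * indicator {0..s} u \<partial>lborel) \<le>
          (\<integral>\<^sup>+u. ennreal (excess u) * indicator {0..t} u \<partial>lborel)"
        using s by (intro nn_integral_mono) (auto split: split_indicator)
      also have "\<dots> \<le> ennreal (C * ?p)"
        using elim(2) by (intro excess) auto
      finally have J: "(\<integral>\<^sup>+u. ennreal (excess u) * indicator {0..s} u \<partial>lborel) \<le> ennreal (C * ?p)" .
      have U: "s \<le> ?m * (\<Sum>i. prob {\<omega> \<in> space M. S i \<omega> \<le> s})"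
        "?m * (\<Sum>i. prob {\<omega> \<in> space M. S i \<omega> \<le> s}) \<le> s + (?m + C * ?p) / ?c"
        using renewal_function_bounds[OF int _ _ J] s \<open>0 \<le> C\<close> by auto
      have int_min: "integrable M (\<lambda>\<omega>. min (\<eta> \<omega>) x)" if "0 \<le> x" for x
        by (rule integrable_const_bound[where B=x]) (use pos that in auto)
      have "expectation (\<lambda>\<omega>. min (\<eta> \<omega>) s) \<le> expectation (\<lambda>\<omega>. min (\<eta> \<omega>) t)"
      proof (rule integral_mono_AE)
        show "integrable M (\<lambda>\<omega>. min (\<eta> \<omega>) s)" "integrable M (\<lambda>\<omega>. min (\<eta> \<omega>) t)"
          using s int_min by auto
      qed (use s in auto)
      also have "\<dots> \<le> B * ?p"
        using elim(1) by simp
      finally have "(1 + expectation (\<lambda>\<omega>. min (\<eta> \<omega>) s)) / ?c \<le> (1 + B * ?p) / ?c"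
        using trunc_mean_pos by (intro divide_right_mono) auto
      then have "?m * ((\<Sum>i. prob {\<omega> \<in> space M. S i \<omega> \<le> s}) - mean_visits M X Y s) \<le> ?m * ((1 + B * ?p) / ?c)"
        using renewal_minus_mean_visits[of s] s m_nonneg by (intro mult_left_mono) auto
      with U(1) have lower: "s - ?m * mean_visits M X Y s \<le> ?m * (1 + B * ?p) / ?c"
        by (simp add: right_diff_distrib)
      have "?m * mean_visits M X Y s \<le> ?m * (\<Sum>i. prob {\<omega> \<in> space M. S i \<omega> \<le> s})"
        by (intro mult_left_mono mean_visits_le_renewal m_nonneg)
      with U(2) have upper: "?m * mean_visits M X Y s - s \<le> (?m + C * ?p) / ?c"
        by simp
      have mp: "?m \<le> ?m * ?p" "?m * (B * ?p) \<ge> 0" "0 \<le> C * ?p"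
        using p m_nonneg \<open>0 < B\<close> \<open>0 \<le> C\<close> by (auto simp: mult_le_cancel_left1)
      have "(?m + C * ?p) / ?c \<le> ?K * ?p" "?m * (1 + B * ?p) / ?c \<le> ?K * ?p"
        unfolding times_divide_eq_left using mp m_nonneg trunc_mean_pos
        by (auto intro!: divide_right_mono simp: algebra_simps less_imp_le)
      with lower upper show "\<bar>?m * mean_visits M X Y s - s\<bar> \<le> ?K * ?p"
        by (simp add: abs_le_iff)
    qed
  qed
  moreover have "0 \<le> ?K"
    using m_nonneg \<open>0 \<le> C\<close> \<open>0 < B\<close> trunc_mean_pos by (intro divide_nonneg_pos add_nonneg_nonneg) auto
  ultimately show ?thesis by blast
qed

end

theorem theorem2p2:
  fixes M :: "'a measure"
    and \<xi> \<eta> :: "'a \<Rightarrow> real"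
    and X Y :: "nat \<Rightarrow> 'a \<Rightarrow> real"
    and r :: real
    and j :: "real \<Rightarrow> nat"
  assumes "prob_space M"
    and "\<xi> \<in> borel_measurable M" and "\<eta> \<in> borel_measurable M"
    and "AE \<omega> in M. \<xi> \<omega> > 0 \<and> \<eta> \<omega> > 0"
    and "prob_space.indep_vars M (\<lambda>_. borel :: (real \<times> real) measure) (\<lambda>i \<omega>. (X i \<omega>, Y i \<omega>)) {1..}"
    and "\<And>i. i \<ge> 1 \<Longrightarrow> distr M (borel :: (real \<times> real) measure) (\<lambda>\<omega>. (X i \<omega>, Y i \<omega>))
                       = distr M borel (\<lambda>\<omega>. (\<xi> \<omega>, \<eta> \<omega>))"
    and "(1 < r \<and> r \<le> 2 \<and> integrable M (\<lambda>\<omega>. \<xi> \<omega> powr r)) \<or>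
         (1 < r \<and> r < 2 \<and>
           (\<exists>b>0. (\<lambda>t. measure M {\<omega> \<in> space M. \<xi> \<omega> > t}) \<sim>[at_top] (\<lambda>t. b * t powr (- r))))"
    and "(\<lambda>t. \<integral>\<omega>. min (\<eta> \<omega>) t \<partial>M) \<in> O[at_top](\<lambda>t. t powr (2 - r))"
    and "\<And>t. t \<ge> 0 \<Longrightarrow> j t \<ge> 1"
    and "(\<lambda>t. real (j t)) \<in> o[at_top](\<lambda>t. t powr ((r - 1) / 2))"
  shows "integrable M \<xi> \<and>
         (\<lambda>t. stieltjes_conv_power (mean_visits M X Y) (j t) t) \<sim>[at_top]
         (\<lambda>t. t ^ j t / ((\<integral>\<omega>. \<xi> \<omega> \<partial>M) ^ j t * fact (j t)))"
proof -
  interpret prob_space M by fact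
  interpret perturbed_random_walk M \<xi> \<eta> X Y
    using assms(2-6) by unfold_locales auto
  have xi_pos: "AE \<omega> in M. 0 < \<xi> \<omega>"
    using pos by auto
  have r: "1 < r" "r \<le> 2"
    using assms(7) by auto
  have "integrable M \<xi> \<and> (\<exists>C\<ge>0. \<forall>t>0.
      (\<integral>\<^sup>+u. ennreal (excess u) * indicator {0..t} u \<partial>lborel) \<le> ennreal (C * t powr (2 - r)))"
    using assms(7)
  proof (elim disjE conjE exE)
    assume "integrable M (\<lambda>\<omega>. \<xi> \<omega> powr r)"
    then show ?thesis
      using integrable_of_powr_moment[OF xi_measurable xi_pos, of r]
        excess_integral_of_powr_moment[OF xi_measurable xi_pos, of r] r
      by (auto intro!: exI[of _ "expectation (\<lambda>\<omega>. \<xi> \<omega> powr r)"])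
  next
    fix b assume "r < 2" "0 < b" "(\<lambda>t. prob {\<omega> \<in> space M. t < \<xi> \<omega>}) \<sim>[at_top] (\<lambda>t. b * t powr (- r))"
    then obtain C where "0 \<le> C" "\<And>y. 0 < y \<Longrightarrow> prob {\<omega> \<in> space M. y < \<xi> \<omega>} \<le> C * y powr (- r)"
      using tail_bound_of_asymp_equiv[of b r \<xi>] r by auto
    then show ?thesis
      using integrable_of_tail[OF xi_measurable xi_pos \<open>1 < r\<close>, of C] excess_integral_of_tail[OF xi_measurable xi_pos \<open>1 < r\<close> \<open>r < 2\<close>, of C] r
      by (auto intro!: exI[of _ "C / (r - 1) / (2 - r)"])
  qed
  then obtain C where int: "integrable M \<xi>" and "0 \<le> C" and C: "\<And>t. 0 < t \<Longrightarrow>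
      (\<integral>\<^sup>+u. ennreal (excess u) * indicator {0..t} u \<partial>lborel) \<le> ennreal (C * t powr (2 - r))"
    by blast
  obtain K where K: "\<forall>\<^sub>F t in at_top. \<forall>s\<in>{0..t}. \<bar>expectation \<xi> * mean_visits M X Y s - s\<bar> \<le> K * t powr (2 - r)"
    using mean_visits_linear[OF int \<open>r \<le> 2\<close> \<open>0 \<le> C\<close> C assms(8)] by blast
  have m_pos: "0 < expectation \<xi>"
    using trunc_mean_pos integral_mono[OF integrable_min_xi int] by fastforce
  have "((\<lambda>t. real (j t) / t powr ((r - 1) / 2)) \<longlongrightarrow> 0) at_top"
    using assms(10) by (rule smalloD_tendsto)
  then have "((\<lambda>t. K * (real (j t) / t powr ((r - 1) / 2))\<^sup>2) \<longlongrightarrow> K * 0\<^sup>2) at_top"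
    by (intro tendsto_intros)
  then have "((\<lambda>t. K * (real (j t) / t powr ((r - 1) / 2))\<^sup>2) \<longlongrightarrow> 0) at_top"
    by simp
  moreover have "\<forall>\<^sub>F t in at_top. K * (real (j t) / t powr ((r - 1) / 2))\<^sup>2 = (real (j t))\<^sup>2 * (K * t powr (2 - r) / t)"
    using eventually_gt_at_top[of 0]
  proof eventually_elim
    case (elim t)
    have sq: "(t powr ((r - 1) / 2))\<^sup>2 = t powr (r - 1)"
      by (simp add: power2_eq_square powr_add[symmetric])
    have "K * (real (j t) / t powr ((r - 1) / 2))\<^sup>2 = (real (j t))\<^sup>2 * K * (1 / t powr (r - 1))"
      by (simp add: power_divide sq)
    also have "1 / t powr (r - 1) = t powr (2 - r) / t"
      using elim powr_diff[of t 1 "r - 1"] by (simp add: powr_diff)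
    finally show ?case
      by simp
  qed
  ultimately have small: "((\<lambda>t. (real (j t))\<^sup>2 * (K * t powr (2 - r) / t)) \<longlongrightarrow> 0) at_top"
    by (rule Lim_transform_eventually)
  have "\<forall>\<^sub>F t in at_top. 1 \<le> j t"
    using eventually_ge_at_top[of 0] by eventually_elim (rule assms(9))
  then show ?thesis
    using stieltjes_function.conv_power_asymp_equiv[OF stieltjes_function_mean_visits m_pos K _ small] int by simp
qed

end
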